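(* Let $\mathcal{H}$ be a complex Hilbert space. Every operator $T\in\mathcal{B}(\mathcal{H})$ similar to a contraction admits a minimal quasi-isometric lifting which is similar to an isometry.
   Context: $T$ is similar to a contraction if there is an invertible positive $A\in\mathcal{B}(\mathcal{H})$ with $T^*AT\le A$. When $\mathcal{K}\supset\mathcal{H}$ is a Hilbert space containing $\mathcal{H}$ as a closed subspace and $P_{\mathcal{K},\mathcal{H}}:\mathcal{K}\to\mathcal{H}$ is the orthogonal projection, $S\in\mathcal{B}(\mathcal{K})$ is a lifting for $T$ if $P_{\mathcal{K},\mathcal{H}}S=TP_{\mathcal{K},\mathcal{H}}$; it is minimal if $\mathcal{K}$ is the closed linear span of $\bigcup_{n\ge0}S^n\mathcal{H}$. $S$ is a quasi-isometry (quasi-isometric) if $S^{*2}S^2=S^*S$. *)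

theory Defs
  imports "HOL-Analysis.Analysis"
begin

section \<open>Complex Hilbert spaces\<close>

text \<open>The inner product \<open>cinner\<close> is linear in its first argument; the real inner product of the
  library is its real part, so norm, topology and completeness are the ones of \<^class>\<open>real_inner\<close>.\<close>

class complex_inner = real_inner +
  fixes scaleC :: "complex \<Rightarrow> 'a \<Rightarrow> 'a"  (infixr \<open>*\<^sub>C\<close> 75)
    and cinner :: "'a \<Rightarrow> 'a \<Rightarrow> complex"
  assumes scaleC_add_right: "c *\<^sub>C (x + y) = c *\<^sub>C x + c *\<^sub>C y"
    and scaleC_add_left: "(c + d) *\<^sub>C x = c *\<^sub>C x + d *\<^sub>C x"
    and scaleC_scaleC: "c *\<^sub>C (d *\<^sub>C x) = (c * d) *\<^sub>C x"
    and scaleC_of_real: "complex_of_real r *\<^sub>C x = r *\<^sub>R x"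
    and cinner_commute: "cinner x y = cnj (cinner y x)"
    and cinner_add_left: "cinner (x + y) z = cinner x z + cinner y z"
    and cinner_scaleC_left: "cinner (c *\<^sub>C x) y = c * cinner x y"
    and inner_eq_Re_cinner: "inner x y = Re (cinner x y)"

class chilbert_space = complex_inner + complete_space

lemma scaleC_one: "1 *\<^sub>C x = (x :: 'a::complex_inner)"
  using scaleC_of_real[of 1 x] by simp

global_interpretation complex_vector: vector_space
  "scaleC :: complex \<Rightarrow> 'a \<Rightarrow> 'a::complex_inner"
  defines csubspace = complex_vector.subspace
    and cspan = complex_vector.span
  by unfold_locales (auto simp: scaleC_add_right scaleC_add_left scaleC_scaleC scaleC_one)

abbreviation clinear :: "('a::complex_inner \<Rightarrow> 'b::complex_inner) \<Rightarrow> bool" where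
  "clinear \<equiv> Vector_Spaces.linear scaleC scaleC"

lemma cinner_self: "cinner x x = complex_of_real ((norm (x :: 'a::complex_inner))\<^sup>2)"
proof -
  have "cinner x x = cnj (cinner x x)"
    by (rule cinner_commute)
  then have "Im (cinner x x) = 0"
    by (metis Reals_cnj_iff complex_is_Real_iff)
  moreover have "Re (cinner x x) = (norm x)\<^sup>2"
    by (simp add: inner_eq_Re_cinner[symmetric] power2_norm_eq_inner)
  ultimately show ?thesis
    by (simp add: complex_eq_iff)
qed

lemma norm_scaleC: "norm (c *\<^sub>C x) = cmod c * norm (x :: 'a::complex_inner)"
proof -
  have "cinner (c *\<^sub>C x) (c *\<^sub>C x) = c * cnj c * cinner x x"
    by (metis cinner_commute cinner_scaleC_left complex_cnj_mult mult.assoc mult.commute)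
  also have "\<dots> = complex_of_real ((cmod c * norm x)\<^sup>2)"
    by (simp add: cinner_self complex_norm_square[symmetric] power_mult_distrib)
  finally have "complex_of_real ((norm (c *\<^sub>C x))\<^sup>2) = complex_of_real ((cmod c * norm x)\<^sup>2)"
    by (simp only: cinner_self)
  then have "(norm (c *\<^sub>C x))\<^sup>2 = (cmod c * norm x)\<^sup>2"
    by (simp only: of_real_eq_iff)
  then show ?thesis
    by (simp add: power2_eq_iff_nonneg)
qed

lemma norm_cinner_le: "cmod (cinner x y) \<le> norm x * norm (y :: 'a::complex_inner)"
proof (cases "cinner x y = 0")
  case False
  define c where "c = cnj (cinner x y) / cmod (cinner x y)"
  have c: "cmod c = 1"
    using False by (simp add: c_def norm_divide)
  have "c * cinner x y = complex_of_real (cmod (cinner x y))"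
    using False
    by (simp add: c_def complex_norm_square[symmetric] mult.commute[of "cnj _"] power2_eq_square)
  then have "cmod (cinner x y) = inner (c *\<^sub>C x) y"
    by (simp add: inner_eq_Re_cinner cinner_scaleC_left)
  also have "\<dots> \<le> norm (c *\<^sub>C x) * norm y"
    by (rule norm_cauchy_schwarz)
  finally show ?thesis
    by (simp add: norm_scaleC c)
qed simp


section \<open>The Hilbert space of square-summable sequences\<close>

typedef (overloaded) 'a ell2 =
  "{f :: nat \<Rightarrow> 'a::chilbert_space. summable (\<lambda>n. (norm (f n))\<^sup>2)}"
  morphisms ell2_nth Abs_ell2
  by (rule exI[of _ "\<lambda>_. 0"]) simp

setup_lifting type_definition_ell2

lemma summable_ell2_nth: "summable (\<lambda>n. (norm (ell2_nth x n))\<^sup>2)"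
  using ell2_nth[of x] by simp

lemma square_summable_add:
  fixes f g :: "nat \<Rightarrow> 'a::chilbert_space"
  assumes "summable (\<lambda>n. (norm (f n))\<^sup>2)" "summable (\<lambda>n. (norm (g n))\<^sup>2)"
  shows "summable (\<lambda>n. (norm (f n + g n))\<^sup>2)"
proof (rule summable_comparison_test)
  have *: "(norm (x + y))\<^sup>2 \<le> 2 * (norm x)\<^sup>2 + 2 * (norm y)\<^sup>2" for x y :: 'a
  proof -
    have "(norm (x + y))\<^sup>2 \<le> (norm x + norm y)\<^sup>2"
      by (intro power_mono norm_triangle_ineq) auto
    also have "\<dots> \<le> 2 * (norm x)\<^sup>2 + 2 * (norm y)\<^sup>2"
      using zero_le_power2[of "norm x - norm y"] by (simp add: power2_eq_square algebra_simps)
    finally show ?thesis .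
  qed
  then show "\<exists>N. \<forall>n\<ge>N. norm ((norm (f n + g n))\<^sup>2) \<le> 2 * (norm (f n))\<^sup>2 + 2 * (norm (g n))\<^sup>2"
    by auto
  show "summable (\<lambda>n. 2 * (norm (f n))\<^sup>2 + 2 * (norm (g n))\<^sup>2)"
    using assms by (intro summable_add summable_mult)
qed

lemma square_summable_scaleC:
  fixes f :: "nat \<Rightarrow> 'a::chilbert_space"
  assumes "summable (\<lambda>n. (norm (f n))\<^sup>2)"
  shows "summable (\<lambda>n. (norm (c *\<^sub>C f n))\<^sup>2)"
  using summable_mult[OF assms, of "(cmod c)\<^sup>2"] by (simp add: norm_scaleC power_mult_distrib)

lemma summable_cinner:
  fixes f g :: "nat \<Rightarrow> 'a::chilbert_space"
  assumes "summable (\<lambda>n. (norm (f n))\<^sup>2)" "summable (\<lambda>n. (norm (g n))\<^sup>2)"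
  shows "summable (\<lambda>n. cinner (f n) (g n))"
proof (rule summable_comparison_test)
  have "cmod (cinner x y) \<le> (norm x)\<^sup>2 + (norm y)\<^sup>2" for x y :: 'a
    using norm_cinner_le[of x y] zero_le_power2[of "norm x - norm y"] norm_ge_zero[of x]
      norm_ge_zero[of y] mult_nonneg_nonneg[of "norm x" "norm y"]
    unfolding power2_diff by linarith
  then show "\<exists>N. \<forall>n\<ge>N. norm (cinner (f n) (g n)) \<le> (norm (f n))\<^sup>2 + (norm (g n))\<^sup>2"
    by auto
  show "summable (\<lambda>n. (norm (f n))\<^sup>2 + (norm (g n))\<^sup>2)"
    using assms by (rule summable_add)
qed

instantiation ell2 :: (chilbert_space) real_vector
begin

lift_definition zero_ell2 :: "'a ell2" is "\<lambda>_. 0" by simp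
lift_definition plus_ell2 :: "'a ell2 \<Rightarrow> 'a ell2 \<Rightarrow> 'a ell2" is "\<lambda>f g n. f n + g n"
  by (rule square_summable_add)
lift_definition uminus_ell2 :: "'a ell2 \<Rightarrow> 'a ell2" is "\<lambda>f n. - f n" by simp
lift_definition minus_ell2 :: "'a ell2 \<Rightarrow> 'a ell2 \<Rightarrow> 'a ell2" is "\<lambda>f g n. f n - g n"
  subgoal for f g using square_summable_add[of f "\<lambda>n. - g n"] by simp
  done
lift_definition scaleR_ell2 :: "real \<Rightarrow> 'a ell2 \<Rightarrow> 'a ell2" is "\<lambda>r f n. r *\<^sub>R f n"
  subgoal for r f using square_summable_scaleC[of f "complex_of_real r"]
    by (simp add: scaleC_of_real)
  done

instance
proof
  fix x y z :: "'a ell2" and r s :: real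
  show "x + y + z = x + (y + z)" "x + y = y + x" "0 + x = x" "- x + x = 0" "x - y = x + - y"
    by (transfer; simp add: algebra_simps)+
  show "r *\<^sub>R (x + y) = r *\<^sub>R x + r *\<^sub>R y" "(r + s) *\<^sub>R x = r *\<^sub>R x + s *\<^sub>R x"
    "r *\<^sub>R s *\<^sub>R x = (r * s) *\<^sub>R x" "1 *\<^sub>R x = x"
    by (transfer; simp add: algebra_simps)+
qed

end

instantiation ell2 :: (chilbert_space) complex_inner
begin

lift_definition scaleC_ell2 :: "complex \<Rightarrow> 'a ell2 \<Rightarrow> 'a ell2" is "\<lambda>c f n. c *\<^sub>C f n"
  by (rule square_summable_scaleC)
definition cinner_ell2 :: "'a ell2 \<Rightarrow> 'a ell2 \<Rightarrow> complex" where
  "cinner_ell2 x y = (\<Sum>n. cinner (ell2_nth x n) (ell2_nth y n))"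
definition inner_ell2 :: "'a ell2 \<Rightarrow> 'a ell2 \<Rightarrow> real" where
  "inner_ell2 x y = Re (cinner x y)"
definition norm_ell2 :: "'a ell2 \<Rightarrow> real" where
  "norm_ell2 x = sqrt (inner x x)"
definition sgn_ell2 :: "'a ell2 \<Rightarrow> 'a ell2" where
  "sgn_ell2 x = x /\<^sub>R norm x"
definition dist_ell2 :: "'a ell2 \<Rightarrow> 'a ell2 \<Rightarrow> real" where
  "dist_ell2 x y = norm (x - y)"
definition uniformity_ell2 :: "('a ell2 \<times> 'a ell2) filter" where
  "uniformity_ell2 = (INF e\<in>{0 <..}. principal {(x, y). dist x y < e})"
definition open_ell2 :: "'a ell2 set \<Rightarrow> bool" where
  "open_ell2 U \<longleftrightarrow> (\<forall>x\<in>U. eventually (\<lambda>(x', y). x' = x \<longrightarrow> y \<in> U) uniformity)"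

instance
proof
  fix x y z :: "'a ell2" and c d :: complex and r :: real and U :: "'a ell2 set"
  have sc: "summable (\<lambda>n. cinner (ell2_nth u n) (ell2_nth v n))" for u v :: "'a ell2"
    by (intro summable_cinner summable_ell2_nth)
  have cself: "cinner u u = complex_of_real (\<Sum>n. (norm (ell2_nth u n))\<^sup>2)" for u :: "'a ell2"
    unfolding cinner_ell2_def cinner_self by (rule suminf_of_real[OF summable_ell2_nth, symmetric])
  have ccom: "cinner u v = cnj (cinner v u)" for u v :: "'a ell2"
  proof -
    have "(\<lambda>n. cinner (ell2_nth v n) (ell2_nth u n)) sums cinner v u"
      unfolding cinner_ell2_def by (rule summable_sums[OF sc])
    then have "(\<lambda>n. cnj (cinner (ell2_nth v n) (ell2_nth u n))) sums cnj (cinner v u)"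
      by (simp add: sums_cnj)
    then show ?thesis
      unfolding cinner_ell2_def by (subst cinner_commute) (rule sums_unique[symmetric])
  qed
  have cadd: "cinner (x + y) z = cinner x z + cinner y z"
    by (simp add: cinner_ell2_def plus_ell2.rep_eq cinner_add_left suminf_add sc)
  have cscale: "cinner (c *\<^sub>C x) y = c * cinner x y" for c and x y :: "'a ell2"
    by (simp add: cinner_ell2_def scaleC_ell2.rep_eq cinner_scaleC_left suminf_mult sc)
  have real: "complex_of_real r *\<^sub>C x = r *\<^sub>R x" for r and x :: "'a ell2"
    by transfer (simp add: scaleC_of_real)
  show "c *\<^sub>C (x + y) = c *\<^sub>C x + c *\<^sub>C y" "(c + d) *\<^sub>C x = c *\<^sub>C x + d *\<^sub>C x"
    "c *\<^sub>C d *\<^sub>C x = (c * d) *\<^sub>C x"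
    by (transfer; simp add: scaleC_add_right scaleC_add_left scaleC_scaleC)+
  show "complex_of_real r *\<^sub>C x = r *\<^sub>R x" by (rule real)
  show "cinner x y = cnj (cinner y x)" by (rule ccom)
  show "cinner (x + y) z = cinner x z + cinner y z" by (rule cadd)
  show "cinner (c *\<^sub>C x) y = c * cinner x y" by (rule cscale)
  show "inner x y = Re (cinner x y)" by (rule inner_ell2_def)
  show "sgn x = x /\<^sub>R norm x" by (rule sgn_ell2_def)
  show "dist x y = norm (x - y)" by (rule dist_ell2_def)
  show "uniformity = (INF e\<in>{0 <..}. principal {(x, y). dist (x :: 'a ell2) y < e})"
    by (rule uniformity_ell2_def)
  show "open U \<longleftrightarrow> (\<forall>x\<in>U. eventually (\<lambda>(x', y). x' = x \<longrightarrow> y \<in> U) uniformity)"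
    by (rule open_ell2_def)
  show "norm x = sqrt (inner x x)" by (rule norm_ell2_def)
  show "inner x y = inner y x"
    unfolding inner_ell2_def by (subst ccom) simp
  show "inner (x + y) z = inner x z + inner y z"
    by (simp add: inner_ell2_def cadd)
  show "inner (r *\<^sub>R x) y = r * inner x y"
    by (simp add: inner_ell2_def real[symmetric] cscale)
  show "0 \<le> inner x x"
    by (simp add: inner_ell2_def cself suminf_nonneg summable_ell2_nth)
  have "inner x x = 0 \<longleftrightarrow> (\<forall>n. ell2_nth x n = 0)"
    using suminf_eq_zero_iff[OF summable_ell2_nth[of x]] by (simp add: inner_ell2_def cself)
  then show "inner x x = 0 \<longleftrightarrow> x = 0"
    by (metis ell2_nth_inject ext zero_ell2.rep_eq)
qed

end

lemma norm_ell2_eq: "(norm x)\<^sup>2 = (\<Sum>n. (norm (ell2_nth x n))\<^sup>2)"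
proof -
  have "cinner x x = complex_of_real (\<Sum>n. (norm (ell2_nth x n))\<^sup>2)"
    unfolding cinner_ell2_def cinner_self by (rule suminf_of_real[OF summable_ell2_nth, symmetric])
  then show ?thesis
    by (simp only: cinner_self of_real_eq_iff)
qed

lemma sum_ell2_nth_le: "(\<Sum>i<k. (norm (ell2_nth x i))\<^sup>2) \<le> (norm x)\<^sup>2"
  unfolding norm_ell2_eq by (rule sum_le_suminf[OF summable_ell2_nth]) auto

lemma norm_ell2_nth_le: "norm (ell2_nth x i) \<le> norm x"
proof -
  have "(norm (ell2_nth x i))\<^sup>2 \<le> (\<Sum>j<Suc i. (norm (ell2_nth x j))\<^sup>2)"
    by (simp add: sum_nonneg)
  also have "\<dots> \<le> (norm x)\<^sup>2"
    by (rule sum_ell2_nth_le)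
  finally show ?thesis
    by (rule power2_le_imp_le) simp
qed

instance ell2 :: (chilbert_space) chilbert_space
proof
  fix X :: "nat \<Rightarrow> 'a ell2"
  assume X: "Cauchy X"
  have "Cauchy (\<lambda>m. ell2_nth (X m) i)" for i
  proof (rule metric_CauchyI)
    fix e :: real assume "e > 0"
    then obtain N where "\<forall>m\<ge>N. \<forall>n\<ge>N. dist (X m) (X n) < e"
      using metric_CauchyD[OF X] by blast
    moreover have "dist (ell2_nth (X m) i) (ell2_nth (X n) i) \<le> dist (X m) (X n)" for m n
      using norm_ell2_nth_le[of "X m - X n" i] by (simp add: dist_norm minus_ell2.rep_eq)
    ultimately show "\<exists>N. \<forall>m\<ge>N. \<forall>n\<ge>N. dist (ell2_nth (X m) i) (ell2_nth (X n) i) < e"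
      by (meson le_less_trans)
  qed
  then have "\<forall>i. \<exists>l. (\<lambda>m. ell2_nth (X m) i) \<longlonglongrightarrow> l"
    using Cauchy_convergent convergent_def by blast
  then obtain f where f: "\<And>i. (\<lambda>m. ell2_nth (X m) i) \<longlonglongrightarrow> f i"
    by metis
  have bound: "\<exists>N. \<forall>m\<ge>N. \<forall>k. (\<Sum>i<k. (norm (ell2_nth (X m) i - f i))\<^sup>2) \<le> e\<^sup>2" if "e > 0" for e
  proof -
    obtain N where N: "\<forall>m\<ge>N. \<forall>n\<ge>N. dist (X m) (X n) < e"
      using metric_CauchyD[OF X \<open>e > 0\<close>] by blast
    have "(\<Sum>i<k. (norm (ell2_nth (X m) i - f i))\<^sup>2) \<le> e\<^sup>2" if "m \<ge> N" for m k
    proof (rule tendsto_upperbound)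
      show "(\<lambda>n. \<Sum>i<k. (norm (ell2_nth (X m) i - ell2_nth (X n) i))\<^sup>2)
          \<longlonglongrightarrow> (\<Sum>i<k. (norm (ell2_nth (X m) i - f i))\<^sup>2)"
        by (intro tendsto_intros f)
      have "(\<Sum>i<k. (norm (ell2_nth (X m) i - ell2_nth (X n) i))\<^sup>2) \<le> e\<^sup>2" if "n \<ge> N" for n
      proof -
        have "(\<Sum>i<k. (norm (ell2_nth (X m) i - ell2_nth (X n) i))\<^sup>2) \<le> (norm (X m - X n))\<^sup>2"
          using sum_ell2_nth_le[where x = "X m - X n"] by (simp add: minus_ell2.rep_eq)
        also have "\<dots> \<le> e\<^sup>2"
          using N \<open>m \<ge> N\<close> \<open>n \<ge> N\<close> by (intro power_mono) (auto simp: dist_norm intro: less_imp_le)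
        finally show ?thesis .
      qed
      then show "\<forall>\<^sub>F n in sequentially. (\<Sum>i<k. (norm (ell2_nth (X m) i - ell2_nth (X n) i))\<^sup>2) \<le> e\<^sup>2"
        by (auto simp: eventually_sequentially)
    qed simp
    then show ?thesis by blast
  qed
  have diff: "summable (\<lambda>i. (norm (ell2_nth (X m) i - f i))\<^sup>2)"
    if "\<forall>k. (\<Sum>i<k. (norm (ell2_nth (X m) i - f i))\<^sup>2) \<le> c" for m c
    by (rule summableI_nonneg_bounded[where x = c]) (use that in auto)
  obtain M where M: "\<forall>k. (\<Sum>i<k. (norm (ell2_nth (X M) i - f i))\<^sup>2) \<le> 1\<^sup>2"
    using bound[of 1] by auto
  have "summable (\<lambda>i. (norm (f i - ell2_nth (X M) i))\<^sup>2)"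
    using diff[OF M] by (simp add: norm_minus_commute)
  from square_summable_add[OF this summable_ell2_nth[of "X M"]]
  have fsum: "summable (\<lambda>i. (norm (f i))\<^sup>2)" by simp
  then have nth: "ell2_nth (Abs_ell2 f) = f"
    by (simp add: Abs_ell2_inverse)
  have "X \<longlonglongrightarrow> Abs_ell2 f"
  proof (rule metric_LIMSEQ_I)
    fix e :: real assume "e > 0"
    then obtain N where N: "\<forall>m\<ge>N. \<forall>k. (\<Sum>i<k. (norm (ell2_nth (X m) i - f i))\<^sup>2) \<le> (e / 2)\<^sup>2"
      using bound[of "e / 2"] by auto
    have "dist (X m) (Abs_ell2 f) < e" if "m \<ge> N" for m
    proof -
      have "(norm (X m - Abs_ell2 f))\<^sup>2 \<le> (e / 2)\<^sup>2"
        unfolding norm_ell2_eq minus_ell2.rep_eq nth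
        by (rule suminf_le_const[OF diff]) (use N that in auto)
      then have "norm (X m - Abs_ell2 f) \<le> e / 2"
        by (rule power2_le_imp_le) (use \<open>e > 0\<close> in simp)
      then show ?thesis
        using \<open>e > 0\<close> by (simp add: dist_norm)
    qed
    then show "\<exists>N. \<forall>n\<ge>N. dist (X n) (Abs_ell2 f) < e" by blast
  qed
  then show "convergent X"
    unfolding convergent_def by blast
qed


section \<open>Bounded operators on a Hilbert space\<close>

text \<open>A Hilbert space is given as a closed complex subspace \<open>K\<close> of an ambient Hilbert space type
  (\<open>K = UNIV\<close> for a whole type), since existence of a Hilbert space cannot be expressed as existence
  of a type. A Hilbert space topologically spanned by countably many bounded linear images of \<open>H\<close> is unitarily
  equivalent to a closed subspace of \<open>\<ell>\<^sup>2(H)\<close>. An operator on \<open>K\<close> is a function of which only the values on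
  \<open>K\<close> matter.\<close>

definition hilbert_subspace :: "'a::chilbert_space set \<Rightarrow> bool" where
  "hilbert_subspace K \<longleftrightarrow> csubspace K \<and> closed K"

definition bounded_ops :: "'a::chilbert_space set \<Rightarrow> ('a \<Rightarrow> 'a) set" where
  "bounded_ops K = {S. S ` K \<subseteq> K \<and>
     (\<forall>x\<in>K. \<forall>y\<in>K. S (x + y) = S x + S y) \<and>
     (\<forall>c. \<forall>x\<in>K. S (c *\<^sub>C x) = c *\<^sub>C S x) \<and>
     (\<exists>B. \<forall>x\<in>K. norm (S x) \<le> B * norm x)}"

definition adjoint_on :: "'a::chilbert_space set \<Rightarrow> ('a \<Rightarrow> 'a) \<Rightarrow> 'a \<Rightarrow> 'a" where
  "adjoint_on K S y = (THE z. z \<in> K \<and> (\<forall>x\<in>K. cinner (S x) y = cinner x z))"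

definition positive_on :: "'a::chilbert_space set \<Rightarrow> ('a \<Rightarrow> 'a) \<Rightarrow> bool" where
  "positive_on K A \<longleftrightarrow> (\<forall>x\<in>K. cinner (A x) x \<in> \<real>\<^sub>\<ge>\<^sub>0)"

definition op_le_on :: "'a::chilbert_space set \<Rightarrow> ('a \<Rightarrow> 'a) \<Rightarrow> ('a \<Rightarrow> 'a) \<Rightarrow> bool" where
  "op_le_on K A B \<longleftrightarrow> positive_on K (\<lambda>x. B x - A x)"

definition inverse_ops_on :: "'a::chilbert_space set \<Rightarrow> ('a \<Rightarrow> 'a) \<Rightarrow> ('a \<Rightarrow> 'a) \<Rightarrow> bool" where
  "inverse_ops_on K A B \<longleftrightarrow>
     A \<in> bounded_ops K \<and> B \<in> bounded_ops K \<and> (\<forall>x\<in>K. A (B x) = x \<and> B (A x) = x)"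

definition invertible_on :: "'a::chilbert_space set \<Rightarrow> ('a \<Rightarrow> 'a) \<Rightarrow> bool" where
  "invertible_on K A \<longleftrightarrow> (\<exists>B. inverse_ops_on K A B)"

definition similar_to_contraction :: "'a::chilbert_space set \<Rightarrow> ('a \<Rightarrow> 'a) \<Rightarrow> bool" where
  "similar_to_contraction K T \<longleftrightarrow>
     (\<exists>A\<in>bounded_ops K. invertible_on K A \<and> positive_on K A \<and>
        op_le_on K (adjoint_on K T \<circ> A \<circ> T) A)"

definition isometry_on :: "'a::chilbert_space set \<Rightarrow> ('a \<Rightarrow> 'a) \<Rightarrow> bool" where
  "isometry_on K V \<longleftrightarrow> V \<in> bounded_ops K \<and> (\<forall>x\<in>K. norm (V x) = norm x)"

definition similar_to_isometry :: "'a::chilbert_space set \<Rightarrow> ('a \<Rightarrow> 'a) \<Rightarrow> bool" where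
  "similar_to_isometry K S \<longleftrightarrow>
     (\<exists>V L M. isometry_on K V \<and> inverse_ops_on K L M \<and> (\<forall>x\<in>K. S x = M (V (L x))))"

definition quasi_isometry_on :: "'a::chilbert_space set \<Rightarrow> ('a \<Rightarrow> 'a) \<Rightarrow> bool" where
  "quasi_isometry_on K S \<longleftrightarrow> S \<in> bounded_ops K \<and>
     (\<forall>x\<in>K. (adjoint_on K S ^^ 2) ((S ^^ 2) x) = adjoint_on K S (S x))"


section \<open>Liftings\<close>

text \<open>The inclusion of \<open>H\<close> (here a whole type) in \<open>K\<close> is an isometric linear map \<open>J\<close>; its range is
  then automatically closed, as \<open>H\<close> is complete.\<close>

definition hilbert_embedding ::
    "'b::chilbert_space set \<Rightarrow> ('a::chilbert_space \<Rightarrow> 'b) \<Rightarrow> bool" where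
  "hilbert_embedding K J \<longleftrightarrow> clinear J \<and> (\<forall>h. norm (J h) = norm h) \<and> range J \<subseteq> K"

text \<open>The orthogonal projection onto \<open>H\<close>: the vector \<open>h\<close> for which \<open>x - J h\<close> is orthogonal
  to the copy \<open>range J\<close> of \<open>H\<close>.\<close>

definition orth_proj :: "('a::chilbert_space \<Rightarrow> 'b::chilbert_space) \<Rightarrow> 'b \<Rightarrow> 'a" where
  "orth_proj J x = (THE h. \<forall>g. cinner (x - J h) (J g) = 0)"

definition lifting_on :: "'b::chilbert_space set \<Rightarrow> ('a::chilbert_space \<Rightarrow> 'b) \<Rightarrow>
    ('a \<Rightarrow> 'a) \<Rightarrow> ('b \<Rightarrow> 'b) \<Rightarrow> bool" where
  "lifting_on K J T S \<longleftrightarrow>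
     S \<in> bounded_ops K \<and> (\<forall>x\<in>K. orth_proj J (S x) = T (orth_proj J x))"

definition minimal_lifting_on :: "'b::chilbert_space set \<Rightarrow> ('a::chilbert_space \<Rightarrow> 'b) \<Rightarrow>
    ('a \<Rightarrow> 'a) \<Rightarrow> ('b \<Rightarrow> 'b) \<Rightarrow> bool" where
  "minimal_lifting_on K J T S \<longleftrightarrow>
     lifting_on K J T S \<and> K = closure (cspan (\<Union>n. (S ^^ n) ` range J))"

end

theory Submission
  imports Defs
begin

text \<open>Let \<open>A\<close> be positive and invertible with \<open>T\<^sup>* A T \<le> A\<close>. After scaling, \<open>A \<ge> 1\<close>, so there are operators
  \<open>E\<close> and \<open>D\<close> with \<open>E\<^sup>2 = A - 1\<close> and \<open>D\<^sup>2 = A - T\<^sup>* A T\<close> (\<open>lifting_data_exists\<close>). On square-summable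
  sequences \<open>x = (h, m, k, l, \<dots>)\<close> put
  \<open>S x = (T h, E T h, D h, m - E h, k, l, \<dots>)\<close>.
  With \<open>H\<close> embedded in position 0 the projection onto \<open>H\<close> is \<open>x \<mapsto> h\<close>, and \<open>S\<close> is a lifting of \<open>T\<close>.

  The choice of \<open>D\<close> and \<open>E\<close> gives
  \<open>\<parallel>S x\<parallel>\<^sup>2 = \<parallel>h\<parallel>\<^sup>2 + \<parallel>E h\<parallel>\<^sup>2 + \<parallel>m - E h\<parallel>\<^sup>2 + \<parallel>k\<parallel>\<^sup>2 + \<dots>\<close> (\<open>norm_lift\<close>).
  For \<open>x\<close> in the range of \<open>S\<close> one has \<open>m = E h\<close>, and then the right side is \<open>\<parallel>x\<parallel>\<^sup>2\<close>. Thus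
  \<open>\<parallel>S (S x)\<parallel> = \<parallel>S x\<parallel>\<close>, which is quasi-isometry. The right side also dominates \<open>\<parallel>x\<parallel>\<^sup>2 / 2\<close>, so \<open>S\<close> is
  bounded below. A quasi-isometry that is bounded below is similar to an isometry: the norm
  \<open>\<parallel>S x\<parallel>\<close> is equivalent to the original one and invariant under \<open>S\<close>, and the positive square root of
  \<open>S\<^sup>* S\<close> transports it to the original norm (\<open>quasi_isometric_similar_to_isometry\<close>). Restricting \<open>S\<close>
  to the closed span \<open>K\<close> of the orbit of \<open>H\<close> makes the lifting minimal and keeps these
  equations and estimates.

  Adjoints, and the square roots of positive operators that occur three times, are constructed on an
  arbitrary closed subspace, because the similarity has to take place inside \<open>K\<close>.\<close>

section \<open>Sesquilinear algebra and bounded operators on a subspace\<close>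

lemma cinner_add_right: "cinner x (y + z) = cinner x y + cinner x (z :: 'a::complex_inner)"
  by (metis cinner_add_left cinner_commute complex_cnj_add)

lemma cinner_scaleC_right: "cinner x (c *\<^sub>C y) = cnj c * cinner x (y :: 'a::complex_inner)"
  by (metis cinner_commute cinner_scaleC_left complex_cnj_mult)

lemma cinner_scaleR_left: "cinner (r *\<^sub>R x) y = r * cinner x (y :: 'a::complex_inner)"
  by (metis cinner_scaleC_left scaleC_of_real)

lemma cinner_scaleR_right: "cinner x (r *\<^sub>R y) = r * cinner x (y :: 'a::complex_inner)"
  by (metis cinner_scaleC_right scaleC_of_real complex_cnj_complex_of_real)

lemma cinner_minus_left: "cinner (- x) y = - cinner x (y :: 'a::complex_inner)"
  using cinner_scaleR_left[of "-1" x y] by simp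

lemma cinner_minus_right: "cinner x (- y) = - cinner x (y :: 'a::complex_inner)"
  using cinner_scaleR_right[of x "-1" y] by simp

lemma cinner_diff_left: "cinner (x - y) z = cinner x z - cinner y (z :: 'a::complex_inner)"
  using cinner_add_left[of x "- y" z] by (simp add: cinner_minus_left)

lemma cinner_diff_right: "cinner x (y - z) = cinner x y - cinner x (z :: 'a::complex_inner)"
  using cinner_add_right[of x y "- z"] by (simp add: cinner_minus_right)

lemmas cinner_simps = cinner_add_left cinner_add_right cinner_diff_left cinner_diff_right
  cinner_scaleC_left cinner_scaleC_right cinner_scaleR_left cinner_scaleR_right

lemma cinner_zero [simp]: "cinner 0 x = 0" "cinner x 0 = 0" for x :: "'a::complex_inner"
  using cinner_scaleR_left[of 0 x x] cinner_scaleR_right[of x 0 x] by simp_all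

lemma Re_cinner_self: "Re (cinner x x) = (norm (x :: 'a::complex_inner))\<^sup>2"
  by (simp add: cinner_self)

lemma csubspace_add: "csubspace K \<Longrightarrow> x \<in> K \<Longrightarrow> y \<in> K \<Longrightarrow> x + y \<in> K"
  by (rule complex_vector.subspace_add)

lemma csubspace_scaleC: "csubspace K \<Longrightarrow> x \<in> K \<Longrightarrow> c *\<^sub>C x \<in> K"
  by (rule complex_vector.subspace_scale)

lemma csubspace_diff: "csubspace K \<Longrightarrow> x \<in> K \<Longrightarrow> y \<in> K \<Longrightarrow> x - y \<in> K"
  by (rule complex_vector.subspace_diff)

lemma csubspace_zero: "csubspace K \<Longrightarrow> 0 \<in> K"
  by (rule complex_vector.subspace_0)

lemma csubspace_scaleR: "csubspace K \<Longrightarrow> x \<in> K \<Longrightarrow> r *\<^sub>R x \<in> K"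
  by (metis csubspace_scaleC scaleC_of_real)

lemmas csubspace_intros = csubspace_add csubspace_scaleC csubspace_diff csubspace_zero
  csubspace_scaleR

lemma hilbert_subspace_UNIV: "hilbert_subspace UNIV"
  by (simp add: hilbert_subspace_def)

lemma bounded_linear_scaleC: "bounded_linear (\<lambda>x :: 'a::complex_inner. c *\<^sub>C x)"
proof (rule bounded_linear_intro)
  show "c *\<^sub>C r *\<^sub>R x = r *\<^sub>R c *\<^sub>C x" for r and x :: 'a
    by (simp add: scaleC_of_real[symmetric] scaleC_scaleC mult.commute)
  show "norm (c *\<^sub>C x) \<le> norm x * cmod c" for x :: 'a
    by (simp add: norm_scaleC mult.commute)
qed (rule scaleC_add_right)

lemma csubspace_closure:
  fixes U :: "'a::chilbert_space set"
  assumes "csubspace U"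
  shows "csubspace (closure U)"
proof (rule complex_vector.subspaceI)
  show "0 \<in> closure U"
    using csubspace_zero[OF assms] closure_subset by blast
next
  fix x y assume "x \<in> closure U" "y \<in> closure U"
  then obtain f g where "\<forall>n. f n \<in> U" "f \<longlonglongrightarrow> x" "\<forall>n. g n \<in> U" "g \<longlonglongrightarrow> y"
    unfolding closure_sequential by blast
  then show "x + y \<in> closure U"
    unfolding closure_sequential using csubspace_add[OF assms]
    by (intro exI[of _ "\<lambda>n. f n + g n"]) (auto intro: tendsto_add)
next
  fix c x assume "x \<in> closure U"
  then obtain f where f: "\<forall>n. f n \<in> U" "f \<longlonglongrightarrow> x"
    unfolding closure_sequential by blast
  from bounded_linear.tendsto[OF bounded_linear_scaleC f(2)]
  show "c *\<^sub>C x \<in> closure U"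
    unfolding closure_sequential using f(1) csubspace_scaleC[OF assms]
    by (intro exI[of _ "\<lambda>n. c *\<^sub>C f n"]) auto
qed

lemma bounded_opsI:
  assumes "\<And>x. x \<in> K \<Longrightarrow> S x \<in> K"
    and "\<And>x y. x \<in> K \<Longrightarrow> y \<in> K \<Longrightarrow> S (x + y) = S x + S y"
    and "\<And>c x. x \<in> K \<Longrightarrow> S (c *\<^sub>C x) = c *\<^sub>C S x"
    and "\<And>x. x \<in> K \<Longrightarrow> norm (S x) \<le> B * norm x"
  shows "S \<in> bounded_ops K"
  unfolding bounded_ops_def using assms by blast

lemma bounded_opsD:
  assumes "S \<in> bounded_ops K"
  shows bounded_ops_in: "x \<in> K \<Longrightarrow> S x \<in> K"
    and bounded_ops_add: "x \<in> K \<Longrightarrow> y \<in> K \<Longrightarrow> S (x + y) = S x + S y"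
    and bounded_ops_scaleC: "x \<in> K \<Longrightarrow> S (c *\<^sub>C x) = c *\<^sub>C S x"
    and bounded_ops_scaleR: "x \<in> K \<Longrightarrow> S (r *\<^sub>R x) = r *\<^sub>R S x"
  using assms by (auto simp: bounded_ops_def scaleC_of_real[symmetric])

lemma bounded_ops_diff:
  assumes "S \<in> bounded_ops K" "csubspace K" "x \<in> K" "y \<in> K"
  shows "S (x - y) = S x - S y"
  using bounded_ops_add[OF assms(1), of "x - y" y] csubspace_diff[OF assms(2-4)] assms(4)
  by (simp add: algebra_simps)

lemma bounded_ops_bound:
  assumes "S \<in> bounded_ops K"
  obtains B where "B > 0" "\<And>x. x \<in> K \<Longrightarrow> norm (S x) \<le> B * norm x"
proof -
  obtain B where B: "\<And>x. x \<in> K \<Longrightarrow> norm (S x) \<le> B * norm x"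
    using assms unfolding bounded_ops_def by blast
  have "norm (S x) \<le> max B 1 * norm x" if "x \<in> K" for x
    using B[OF that] mult_right_mono[of B "max B 1" "norm x"] by simp
  then show thesis using that[of "max B 1"] by simp
qed

lemma bounded_ops_comp:
  assumes F: "F \<in> bounded_ops K" and G: "G \<in> bounded_ops K"
  shows "(\<lambda>x. F (G x)) \<in> bounded_ops K"
proof -
  obtain B where B: "B > 0" "\<And>x. x \<in> K \<Longrightarrow> norm (F x) \<le> B * norm x"
    using bounded_ops_bound[OF F] by blast
  obtain C where C: "C > 0" "\<And>x. x \<in> K \<Longrightarrow> norm (G x) \<le> C * norm x"
    using bounded_ops_bound[OF G] by blast
  have "norm (F (G x)) \<le> (B * C) * norm x" if "x \<in> K" for x
  proof -
    have "norm (F (G x)) \<le> B * norm (G x)" by (rule B(2)[OF bounded_ops_in[OF G that]])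
    also have "\<dots> \<le> B * (C * norm x)" using B(1) by (intro mult_left_mono C(2) that) simp
    finally show ?thesis by (simp add: mult.assoc)
  qed
  then show ?thesis
    by (intro bounded_opsI)
      (auto simp: bounded_opsD[OF F] bounded_opsD[OF G])
qed

lemma bounded_ops_scaled_diff:
  assumes F: "F \<in> bounded_ops K" and G: "G \<in> bounded_ops K" and K: "csubspace K"
  shows "(\<lambda>x. r *\<^sub>R (F x - G x)) \<in> bounded_ops K"
proof -
  obtain B where B: "B > 0" "\<And>x. x \<in> K \<Longrightarrow> norm (F x) \<le> B * norm x"
    using bounded_ops_bound[OF F] by blast
  obtain C where C: "C > 0" "\<And>x. x \<in> K \<Longrightarrow> norm (G x) \<le> C * norm x"
    using bounded_ops_bound[OF G] by blast
  have "norm (r *\<^sub>R (F x - G x)) \<le> (\<bar>r\<bar> * (B + C)) * norm x" if "x \<in> K" for x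
  proof -
    have "norm (F x - G x) \<le> (B + C) * norm x"
      using norm_triangle_ineq4[of "F x" "G x"] B(2)[OF that] C(2)[OF that]
      by (simp add: algebra_simps)
    then show ?thesis
      by (simp add: mult.assoc mult_left_mono)
  qed
  moreover have "r *\<^sub>R (c *\<^sub>C F x - c *\<^sub>C G x) = c *\<^sub>C (r *\<^sub>R (F x - G x))" for c x
    by (simp add: scaleC_of_real[symmetric] scaleC_scaleC
        complex_vector.scale_right_diff_distrib mult.commute)
  ultimately show ?thesis
    by (intro bounded_opsI[where B = "\<bar>r\<bar> * (B + C)"])
      (auto simp: bounded_opsD[OF F] bounded_opsD[OF G] algebra_simps
        intro!: csubspace_intros[OF K] bounded_ops_in[OF F] bounded_ops_in[OF G])
qed

lemma bounded_ops_ident: "(\<lambda>x. x) \<in> bounded_ops K"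
  by (rule bounded_opsI[where B = 1]) auto

lemma bounded_ops_scaled:
  assumes "F \<in> bounded_ops K" "csubspace K"
  shows "(\<lambda>x. r *\<^sub>R F x) \<in> bounded_ops K"
  using bounded_ops_scaled_diff[OF assms(1) bounded_opsI[where B = 0] assms(2), of "\<lambda>_. 0" r]
  by (simp add: csubspace_zero[OF assms(2)])

text \<open>By polarization: the two sides have equal real parts, and the imaginary part of an inner
  product is the real part after multiplying one argument by \<open>\<i>\<close>.\<close>

lemma norm_eq_imp_cinner_eq:
  assumes K: "csubspace K" and F: "F \<in> bounded_ops K" and G: "G \<in> bounded_ops K"
    and eq: "\<And>x. x \<in> K \<Longrightarrow> norm (F x) = norm (G x)" and x: "x \<in> K" and y: "y \<in> K"
  shows "cinner (F x) (F y) = cinner (G x) (G y)"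
proof -
  have re: "inner (F x) (F y) = inner (G x) (G y)" if "x \<in> K" "y \<in> K" for x y
    using eq[OF csubspace_add[OF K that]] eq[OF that(1)] eq[OF that(2)]
      dot_norm[of "F x" "F y"] dot_norm[of "G x" "G y"]
    by (simp add: bounded_ops_add[OF F] bounded_ops_add[OF G] that)
  have im: "Im (cinner u v) = inner u (\<i> *\<^sub>C v)" for u v :: 'a
    by (simp add: inner_eq_Re_cinner cinner_scaleC_right)
  have "inner (F x) (\<i> *\<^sub>C F y) = inner (G x) (\<i> *\<^sub>C G y)"
    using re[OF x csubspace_scaleC[OF K y, of \<i>]]
    by (simp add: bounded_ops_scaleC[OF F] bounded_ops_scaleC[OF G] y)
  then show ?thesis
    using re[OF x y] by (simp add: complex_eq_iff im inner_eq_Re_cinner)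
qed

section \<open>Riesz representation and adjoints\<close>

text \<open>The functional \<open>\<parallel>x\<parallel>\<^sup>2 - 2 f x\<close> is bounded below on \<open>K\<close>, and by the parallelogram law every
  minimizing sequence is Cauchy. At the minimum \<open>z\<close> the derivative in each direction \<open>x\<close>, which is
  \<open>2 (inner x z - f x)\<close>, must vanish.\<close>

lemma riesz_real:
  fixes K :: "'a::chilbert_space set" and f :: "'a \<Rightarrow> real"
  assumes K: "hilbert_subspace K"
    and add: "\<And>x y. x \<in> K \<Longrightarrow> y \<in> K \<Longrightarrow> f (x + y) = f x + f y"
    and scale: "\<And>r x. x \<in> K \<Longrightarrow> f (r *\<^sub>R x) = r * f x"
    and bound: "\<And>x. x \<in> K \<Longrightarrow> \<bar>f x\<bar> \<le> B * norm x"
  shows "\<exists>z\<in>K. \<forall>x\<in>K. f x = inner x z"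
proof -
  have cs: "csubspace K" and cl: "closed K"
    using K by (auto simp: hilbert_subspace_def)
  define g where "g x = (norm x)\<^sup>2 - 2 * f x" for x
  define m where "m = Inf (g ` K)"
  have "- (B\<^sup>2) \<le> g x" if "x \<in> K" for x
  proof -
    have "2 * f x \<le> 2 * (B * norm x)" using bound[OF that] by linarith
    then show ?thesis
      using zero_le_power2[of "norm x - B"]
      by (simp add: g_def power2_diff algebra_simps)
  qed
  then have bdd: "bdd_below (g ` K)" by (auto simp: bdd_below_def)
  have m_le: "m \<le> g x" if "x \<in> K" for x
    unfolding m_def using bdd that by (auto intro: cInf_lower)
  have "\<exists>x\<in>K. g x < m + inverse (Suc n)" for n
  proof -
    have "\<exists>y\<in>g ` K. y < m + inverse (Suc n)"
      unfolding m_def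
      by (rule cInf_lessD) (use csubspace_zero[OF cs] in auto)
    then show ?thesis by auto
  qed
  then obtain u where uK: "\<And>n. u n \<in> K" and u: "\<And>n. g (u n) < m + inverse (Suc n)"
    by metis
  have half: "(norm (x - y))\<^sup>2 \<le> 2 * (g x - m) + 2 * (g y - m)" if "x \<in> K" "y \<in> K" for x y
  proof -
    have "m \<le> g ((1/2) *\<^sub>R (x + y))"
      by (rule m_le) (intro csubspace_intros cs that)
    also have "\<dots> = (norm (x + y))\<^sup>2 / 4 - f x - f y"
      unfolding g_def scale[OF csubspace_add[OF cs that]] add[OF that]
      by (simp add: power_divide power_mult_distrib add_divide_distrib)
    finally have 1: "4 * m \<le> (norm (x + y))\<^sup>2 - 4 * f x - 4 * f y" by simp
    have 2: "(norm (x + y))\<^sup>2 + (norm (x - y))\<^sup>2 = 2 * (norm x)\<^sup>2 + 2 * (norm y)\<^sup>2"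
      by (simp add: power2_norm_eq_inner algebra_simps inner_commute)
    show ?thesis unfolding g_def using 1 2 by (simp add: algebra_simps)
  qed
  have "Cauchy u"
  proof (rule metric_CauchyI)
    fix e :: real assume e: "e > 0"
    then obtain N where N: "inverse (Suc N) < e\<^sup>2 / 4"
      using reals_Archimedean[of "e\<^sup>2 / 4"] by auto
    have "dist (u i) (u j) < e" if "i \<ge> N" "j \<ge> N" for i j
    proof -
      have small: "inverse (Suc k) < e\<^sup>2 / 4" if "k \<ge> N" for k
      proof -
        have "inverse (real (Suc k)) \<le> inverse (real (Suc N))"
          by (rule le_imp_inverse_le) (use that in auto)
        then show ?thesis using N by (rule le_less_trans)
      qed
      have "2 * (g (u i) - m) < e\<^sup>2 / 2" "2 * (g (u j) - m) < e\<^sup>2 / 2"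
        using u[of i] u[of j] small[OF that(1)] small[OF that(2)] by auto
      then have "(norm (u i - u j))\<^sup>2 < e\<^sup>2"
        using half[OF uK uK, of i j] by linarith
      then show ?thesis using e by (simp add: dist_norm power_less_imp_less_base)
    qed
    then show "\<exists>N. \<forall>i\<ge>N. \<forall>j\<ge>N. dist (u i) (u j) < e" by blast
  qed
  then obtain z where z: "u \<longlonglongrightarrow> z"
    using Cauchy_convergent convergent_def by blast
  have zK: "z \<in> K" using closed_sequentially[OF cl _ z] uK by auto
  have fd: "f (x - y) = f x - f y" if "x \<in> K" "y \<in> K" for x y
    using add[OF csubspace_diff[OF cs that] that(2)] by simp
  have "(\<lambda>n. f (u n)) \<longlonglongrightarrow> f z"
  proof (rule Lim_null[THEN iffD2], rule Lim_null_comparison)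
    show "\<forall>\<^sub>F n in sequentially. norm (f (u n) - f z) \<le> B * norm (u n - z)"
      using bound[OF csubspace_diff[OF cs uK zK]] by (simp add: fd uK zK)
    show "(\<lambda>n. B * norm (u n - z)) \<longlonglongrightarrow> 0"
      using tendsto_mult_right_zero[OF tendsto_norm_zero[OF LIM_zero[OF z]]] .
  qed
  then have "(\<lambda>n. g (u n)) \<longlonglongrightarrow> g z"
    unfolding g_def by (intro tendsto_intros z)
  moreover have "(\<lambda>n. m + inverse (real (Suc n))) \<longlonglongrightarrow> m + 0"
    by (intro tendsto_intros LIMSEQ_inverse_real_of_nat)
  ultimately have "g z \<le> m + 0"
    by (rule LIMSEQ_le) (use u in \<open>auto intro: less_imp_le\<close>)
  then have gz: "g z \<le> g x" if "x \<in> K" for x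
    using m_le[OF that] by simp
  have "f x = inner x z" if x: "x \<in> K" for x
  proof (cases "x = 0")
    case False
    define d where "d = inner x z - f x"
    \<comment> \<open>The step minimizing the quadratic \<open>2 t d + t\<^sup>2 \<parallel>x\<parallel>\<^sup>2\<close>.\<close>
    define t where "t = - d / (norm x)\<^sup>2"
    have "g z \<le> g (z + t *\<^sub>R x)"
      by (rule gz) (intro csubspace_intros cs zK x)
    also have "\<dots> = g z + 2 * t * d + t\<^sup>2 * (norm x)\<^sup>2"
      unfolding g_def d_def by (simp add: add scale csubspace_scaleR[OF cs] x zK power2_norm_eq_inner)
        (simp add: algebra_simps inner_commute power2_eq_square)
    finally have "0 \<le> 2 * t * d + t\<^sup>2 * (norm x)\<^sup>2" by simp
    also have "\<dots> = - d\<^sup>2 / (norm x)\<^sup>2"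
      using False by (simp add: t_def power2_eq_square field_simps)
    finally have "d\<^sup>2 / (norm x)\<^sup>2 \<le> 0" by simp
    then have "d = 0" using False by (simp add: divide_le_0_iff)
    then show ?thesis by (simp add: d_def)
  qed (use scale[of 0 0] csubspace_zero[OF cs] in simp)
  then show ?thesis using zK by blast
qed

text \<open>Representing the real part suffices, since \<open>Im (cinner u v)\<close> is \<open>- Re (cinner (\<i> u) v)\<close> and \<open>S\<close>
  commutes with \<open>\<i>\<close>.\<close>

lemma adjoint_exists:
  fixes K :: "'a::chilbert_space set"
  assumes K: "hilbert_subspace K" and S: "S \<in> bounded_ops K" 
  shows "\<exists>z\<in>K. \<forall>x\<in>K. cinner (S x) y = cinner x z"
proof -
  have cs: "csubspace K" using K by (simp add: hilbert_subspace_def)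
  obtain B where B: "B > 0" "\<And>x. x \<in> K \<Longrightarrow> norm (S x) \<le> B * norm x"
    using bounded_ops_bound[OF S] by blast
  have "\<exists>z\<in>K. \<forall>x\<in>K. inner (S x) y = inner x z"
  proof (rule riesz_real[OF K, where B = "B * norm y"])
    fix x assume x: "x \<in> K"
    have "\<bar>inner (S x) y\<bar> \<le> norm (S x) * norm y" by (rule Cauchy_Schwarz_ineq2)
    also have "\<dots> \<le> B * norm x * norm y" by (intro mult_right_mono B x) simp
    finally show "\<bar>inner (S x) y\<bar> \<le> B * norm y * norm x" by (simp add: mult.commute mult.left_commute)
  qed (simp_all add: bounded_opsD[OF S] inner_add_left)
  then obtain z where z: "z \<in> K" and re: "\<And>x. x \<in> K \<Longrightarrow> inner (S x) y = inner x z"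
    by blast
  have im: "Im (cinner u v) = - inner (\<i> *\<^sub>C u) v" for u v :: 'a
    by (simp add: inner_eq_Re_cinner cinner_scaleC_left)
  have "cinner (S x) y = cinner x z" if x: "x \<in> K" for x
    using re[OF x] re[OF csubspace_scaleC[OF cs x, of \<i>]]
    by (simp add: complex_eq_iff im bounded_ops_scaleC[OF S x] inner_eq_Re_cinner)
  then show ?thesis using z by blast
qed

lemma eq_if_cinner_eq:
  fixes K :: "'a::chilbert_space set"
  assumes "csubspace K" "z \<in> K" "w \<in> K" "\<And>x. x \<in> K \<Longrightarrow> cinner x z = cinner x w"
  shows "z = w"
proof -
  have "cinner (z - w) (z - w) = 0"
    using assms(4)[OF csubspace_diff[OF assms(1-3)]] by (simp add: cinner_diff_right)
  then show ?thesis by (simp add: cinner_self)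
qed

lemma adjoint_on_props:
  fixes K :: "'a::chilbert_space set"
  assumes K: "hilbert_subspace K" and S: "S \<in> bounded_ops K"
  shows adjoint_on_in: "adjoint_on K S y \<in> K"
    and cinner_adjoint_on: "x \<in> K \<Longrightarrow> cinner (S x) y = cinner x (adjoint_on K S y)"
proof -
  have cs: "csubspace K" using K by (simp add: hilbert_subspace_def)
  have "\<exists>!z. z \<in> K \<and> (\<forall>x\<in>K. cinner (S x) y = cinner x z)"
    using adjoint_exists[OF K S, of y] eq_if_cinner_eq[OF cs] by metis
  from theI'[OF this] show "adjoint_on K S y \<in> K"
    "x \<in> K \<Longrightarrow> cinner (S x) y = cinner x (adjoint_on K S y)"
    unfolding adjoint_on_def by blast+
qed

lemma adjoint_on_bounded_ops:
  fixes K :: "'a::chilbert_space set"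
  assumes K: "hilbert_subspace K" and S: "S \<in> bounded_ops K"
  shows "adjoint_on K S \<in> bounded_ops K"
proof -
  have cs: "csubspace K" using K by (simp add: hilbert_subspace_def)
  note adj = adjoint_on_props[OF K S]
  obtain B where B: "B > 0" "\<And>x. x \<in> K \<Longrightarrow> norm (S x) \<le> B * norm x"
    using bounded_ops_bound[OF S] by blast
  show ?thesis
  proof (rule bounded_opsI[where B = B])
    fix y assume "y \<in> K"
    let ?z = "adjoint_on K S y"
    have "(norm ?z)\<^sup>2 = Re (cinner (S ?z) y)"
      by (simp add: adj Re_cinner_self)
    also have "\<dots> \<le> norm (S ?z) * norm y"
      by (rule order_trans[OF complex_Re_le_cmod norm_cinner_le])
    also have "\<dots> \<le> B * norm ?z * norm y"
      by (intro mult_right_mono B adj) simp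
    finally have "norm ?z * norm ?z \<le> (B * norm y) * norm ?z"
      by (simp add: power2_eq_square mult.commute mult.left_commute)
    then show "norm ?z \<le> B * norm y"
      using B(1) by (cases "norm ?z = 0") (auto simp: mult_le_cancel_right)
  qed (auto intro!: adj(1) eq_if_cinner_eq[OF cs] csubspace_intros[OF cs]
      simp: adj(2)[symmetric] cinner_simps)
qed

text \<open>Quasi-isometry can be read off from norms: polarizing \<open>\<parallel>S\<^sup>2 x\<parallel> = \<parallel>S x\<parallel>\<close> gives the sesquilinear
  identity that defines \<open>S\<^sup>*\<^sup>2 S\<^sup>2 = S\<^sup>* S\<close>.\<close>

lemma quasi_isometry_onI:
  fixes K :: "'a::chilbert_space set"
  assumes K: "hilbert_subspace K" and S: "S \<in> bounded_ops K"
    and eq: "\<And>x. x \<in> K \<Longrightarrow> norm (S (S x)) = norm (S x)"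
  shows "quasi_isometry_on K S"
  unfolding quasi_isometry_on_def
proof (intro conjI ballI S)
  fix x assume x: "x \<in> K"
  have cs: "csubspace K" using K by (simp add: hilbert_subspace_def)
  note adj = adjoint_on_props[OF K S]
  show "(adjoint_on K S ^^ 2) ((S ^^ 2) x) = adjoint_on K S (S x)"
  proof (rule eq_if_cinner_eq[OF cs])
    fix y assume y: "y \<in> K"
    have "cinner (S (S y)) (S (S x)) = cinner (S y) (S x)"
      by (rule norm_eq_imp_cinner_eq[OF cs bounded_ops_comp[OF S S] S eq y x])
    then show "cinner y ((adjoint_on K S ^^ 2) ((S ^^ 2) x)) = cinner y (adjoint_on K S (S x))"
      by (simp add: numeral_2_eq_2 adj(2)[symmetric] y bounded_ops_in[OF S])
  qed (simp_all add: numeral_2_eq_2 adj(1))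
qed

section \<open>Square roots of positive operators\<close>

lemma positive_onD:
  assumes "positive_on K P" "x \<in> K"
  shows "0 \<le> Re (cinner (P x) x)" "Im (cinner (P x) x) = 0"
  using assms by (auto simp: positive_on_def complex_nonneg_Reals_iff)

text \<open>Over the complex numbers positivity forces self-adjointness: \<open>q u v\<close>, the defect of symmetry,
  vanishes on the diagonal because \<open>cinner (P u) u\<close> is real, and a sesquilinear form that vanishes
  on the diagonal is zero.\<close>

lemma positive_on_symmetric:
  fixes K :: "'a::chilbert_space set"
  assumes K: "csubspace K" and P: "P \<in> bounded_ops K" and pos: "positive_on K P"
    and x: "x \<in> K" and y: "y \<in> K"
  shows "cinner (P x) y = cinner x (P y)"
proof -
  define q where "q u v = cinner (P u) v - cinner u (P v)" for u v
  have q0: "q u u = 0" if "u \<in> K" for u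
  proof -
    have "cinner u (P u) = cnj (cinner (P u) u)" by (rule cinner_commute)
    also have "\<dots> = cinner (P u) u"
      using positive_onD(2)[OF pos that] by (simp add: complex_eq_iff)
    finally show ?thesis by (simp add: q_def)
  qed
  have sum0: "q u v + q v u = 0" if "u \<in> K" "v \<in> K" for u v
    using q0[OF csubspace_add[OF K that]] q0[OF that(1)] q0[OF that(2)]
    by (simp add: q_def bounded_ops_add[OF P] that cinner_simps algebra_simps)
  have "q x (\<i> *\<^sub>C y) = - \<i> * q x y" "q (\<i> *\<^sub>C y) x = \<i> * q y x"
    by (simp_all add: q_def bounded_ops_scaleC[OF P y] cinner_simps algebra_simps)
  then have "\<i> * (q y x - q x y) = 0"
    using sum0[OF x csubspace_scaleC[OF K y, of \<i>]] by (simp add: algebra_simps)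
  then have "q x y = 0" using sum0[OF x y] by simp
  then show ?thesis by (simp add: q_def)
qed

text \<open>The operator inequality \<open>P\<^sup>2 \<le> B P\<close>, obtained by testing positivity on the vector
  \<open>x - P x / B\<close>.\<close>

lemma positive_on_norm_bound:
  fixes K :: "'a::chilbert_space set"
  assumes K: "csubspace K" and P: "P \<in> bounded_ops K" and pos: "positive_on K P"
    and B: "B > 0" "\<And>x. x \<in> K \<Longrightarrow> norm (P x) \<le> B * norm x" and x: "x \<in> K"
  shows "(norm (P x))\<^sup>2 \<le> B * Re (cinner (P x) x)"
proof -
  define t where "t = inverse B"
  have Px: "P x \<in> K" and PPx: "P (P x) \<in> K" using bounded_ops_in[OF P] x by auto
  have sym: "cinner (P (P x)) x = cinner (P x) (P x)"
    by (rule positive_on_symmetric[OF K P pos Px x])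
  have "0 \<le> Re (cinner (P (x - t *\<^sub>R P x)) (x - t *\<^sub>R P x))"
    by (intro positive_onD(1)[OF pos] csubspace_intros K x Px)
  also have "\<dots> = Re (cinner (P x) x) - 2 * t * (norm (P x))\<^sup>2 + t\<^sup>2 * Re (cinner (P (P x)) (P x))"
    by (simp add: bounded_ops_diff[OF P K x csubspace_scaleR[OF K Px]] bounded_ops_scaleR[OF P Px]
        cinner_simps sym Re_cinner_self power2_eq_square algebra_simps)
  also have "Re (cinner (P (P x)) (P x)) \<le> norm (P (P x)) * norm (P x)"
    by (rule order_trans[OF complex_Re_le_cmod norm_cinner_le])
  also have "norm (P (P x)) * norm (P x) \<le> B * (norm (P x))\<^sup>2"
    using mult_right_mono[OF B(2)[OF Px], of "norm (P x)"] by (simp add: power2_eq_square)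
  finally have "0 \<le> Re (cinner (P x) x) - 2 * t * (norm (P x))\<^sup>2 + t\<^sup>2 * (B * (norm (P x))\<^sup>2)"
    by (simp add: mult_left_mono)
  also have "t\<^sup>2 * (B * (norm (P x))\<^sup>2) = t * (norm (P x))\<^sup>2"
    using B(1) by (simp add: t_def power2_eq_square)
  finally have "0 \<le> Re (cinner (P x) x) - t * (norm (P x))\<^sup>2" by simp
  then show ?thesis using B(1) by (simp add: t_def field_simps)
qed

text \<open>The step \<open>x - P x / B\<close> is a contraction, and a strict one where \<open>P\<close> is coercive. The square root
  needs the first fact, its invertibility the second.\<close>

lemma positive_on_damped_step:
  fixes K :: "'a::chilbert_space set"
  assumes K: "csubspace K" and P: "P \<in> bounded_ops K" and pos: "positive_on K P"
    and B: "B > 0" "\<And>x. x \<in> K \<Longrightarrow> norm (P x) \<le> B * norm x" and x: "x \<in> K"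
  shows "(norm (x - inverse B *\<^sub>R P x))\<^sup>2 \<le> (norm x)\<^sup>2 - inverse B * Re (cinner (P x) x)"
proof -
  define c where "c = inverse B"
  have c: "c * B = 1" using B(1) by (simp add: c_def)
  have "Re (cinner (x - c *\<^sub>R P x) (x - c *\<^sub>R P x)) =
      Re (cinner x x) - 2 * c * Re (cinner (P x) x) + c\<^sup>2 * Re (cinner (P x) (P x))"
    by (simp add: cinner_simps positive_on_symmetric[OF K P pos x x] power2_eq_square algebra_simps)
  then have "(norm (x - c *\<^sub>R P x))\<^sup>2 =
      (norm x)\<^sup>2 - 2 * c * Re (cinner (P x) x) + c\<^sup>2 * (norm (P x))\<^sup>2"
    by (simp only: Re_cinner_self)
  also have "c\<^sup>2 * (norm (P x))\<^sup>2 \<le> c\<^sup>2 * (B * Re (cinner (P x) x))"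
    by (intro mult_left_mono positive_on_norm_bound[OF K P pos B x]) simp_all
  also have "\<dots> = c * (c * B) * Re (cinner (P x) x)"
    by (simp add: power2_eq_square)
  finally show ?thesis by (simp add: c c_def[symmetric])
qed

text \<open>The square root of \<open>1 - X\<close> is \<open>1 - Y\<close> for a solution of \<open>Y = (X + Y\<^sup>2) / 2\<close>, which is found by
  iteration from zero. With \<open>X = 1\<close> the same recursion on the reals is an increasing sequence with
  values in the unit interval; it majorizes the operator iterates and their increments, so its
  convergence carries over.\<close>

fun sqrt_majorant :: "nat \<Rightarrow> real" where
  "sqrt_majorant 0 = 0"
| "sqrt_majorant (Suc n) = (1 + (sqrt_majorant n)\<^sup>2) / 2"

lemma sqrt_majorant_nonneg: "0 \<le> sqrt_majorant n"
  by (cases n) auto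

lemma sqrt_majorant_le_1: "sqrt_majorant n \<le> 1"
proof (induction n)
  case (Suc n)
  then show ?case
    using power_mono[OF Suc sqrt_majorant_nonneg, of 2] by simp
qed simp

lemma sqrt_majorant_Suc_diff:
  "sqrt_majorant (Suc (Suc n)) - sqrt_majorant (Suc n) =
    (sqrt_majorant (Suc n) + sqrt_majorant n) * (sqrt_majorant (Suc n) - sqrt_majorant n) / 2"
proof -
  have "sqrt_majorant (Suc (Suc n)) - sqrt_majorant (Suc n) =
      ((sqrt_majorant (Suc n))\<^sup>2 - (sqrt_majorant n)\<^sup>2) / 2"
    unfolding sqrt_majorant.simps(2)[of "Suc n"] using sqrt_majorant.simps(2)[of n]
    by (simp add: field_simps del: sqrt_majorant.simps)
  then show ?thesis
    by (simp add: power2_eq_square algebra_simps del: sqrt_majorant.simps)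
qed

lemma sqrt_majorant_mono: "sqrt_majorant n \<le> sqrt_majorant (Suc n)"
proof -
  have "0 \<le> (sqrt_majorant n - 1)\<^sup>2" by simp
  then show ?thesis by (simp add: power2_diff)
qed

lemma sqrt_majorant_Cauchy: "Cauchy sqrt_majorant"
proof (rule convergent_Cauchy)
  show "convergent sqrt_majorant"
    using incseq_SucI[of sqrt_majorant, OF sqrt_majorant_mono]
    by (intro Bseq_mono_convergent BseqI'[where K = 1])
      (auto simp: sqrt_majorant_nonneg sqrt_majorant_le_1 incseq_def)
qed

fun sqrt_iter :: "('a \<Rightarrow> 'a) \<Rightarrow> nat \<Rightarrow> 'a \<Rightarrow> 'a::real_vector" where
  "sqrt_iter X 0 x = 0"
| "sqrt_iter X (Suc n) x = (1/2) *\<^sub>R (X x + sqrt_iter X n (sqrt_iter X n x))"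

text \<open>Write \<open>Y, Y'\<close> for consecutive iterates and \<open>y, y'\<close> for their majorants. The
  majorization \<open>\<parallel>Y' - Y\<parallel> \<le> y' - y\<close> follows by induction from
  \<open>Y'\<^sup>2 - Y\<^sup>2 = Y' (Y' - Y) + (Y' - Y) Y\<close>, an identity in which no two
  operators are commuted. Hence the iterates converge in operator norm, also when \<open>\<parallel>X\<parallel> = 1\<close>, where
  the recursion is no longer a strict contraction.\<close>

lemma sqrt_of_one_minus:
  fixes K :: "'a::chilbert_space set"
  assumes K: "hilbert_subspace K" and X: "X \<in> bounded_ops K"
    and contr: "\<And>x. x \<in> K \<Longrightarrow> norm (X x) \<le> norm x"
    and sym: "\<And>x y. x \<in> K \<Longrightarrow> y \<in> K \<Longrightarrow> cinner (X x) y = cinner x (X y)"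
  obtains Y where "Y \<in> bounded_ops K"
    "\<And>x y. x \<in> K \<Longrightarrow> y \<in> K \<Longrightarrow> cinner (Y x) y = cinner x (Y y)"
    "\<And>x. x \<in> K \<Longrightarrow> 2 *\<^sub>R Y x = X x + Y (Y x)"
proof -
  have cs: "csubspace K" and cl: "closed K" using K by (auto simp: hilbert_subspace_def)
  define Z where "Z = sqrt_iter X"
  have Z0: "Z 0 x = 0" and ZS: "Z (Suc n) x = (1/2) *\<^sub>R (X x + Z n (Z n x))" for n x
    by (simp_all add: Z_def)
  have ZK: "Z n x \<in> K" if "x \<in> K" for n x
    using that by (induction n arbitrary: x)
      (auto simp: Z0 ZS intro!: csubspace_intros[OF cs] bounded_ops_in[OF X])
  have Zadd: "Z n (x + y) = Z n x + Z n y" if "x \<in> K" "y \<in> K" for n x y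
    using that by (induction n arbitrary: x y) (auto simp: Z0 ZS bounded_ops_add[OF X] ZK algebra_simps)
  have Zscale: "Z n (c *\<^sub>C x) = c *\<^sub>C Z n x" if "x \<in> K" for n x c
    using that by (induction n arbitrary: x)
      (auto simp: Z0 ZS bounded_ops_scaleC[OF X] ZK scaleC_of_real[symmetric] scaleC_scaleC
        scaleC_add_right mult.commute)
  have Zdiff: "Z n (x - y) = Z n x - Z n y" if "x \<in> K" "y \<in> K" for n x y
    using Zadd[OF csubspace_diff[OF cs that] that(2), of n] by simp
  have Zsym: "cinner (Z n x) y = cinner x (Z n y)" if "x \<in> K" "y \<in> K" for n x y
    using that by (induction n arbitrary: x y) (auto simp: Z0 ZS sym ZK cinner_simps)
  let ?y = sqrt_majorant
  have Zbound: "norm (Z n x) \<le> ?y n * norm x" if "x \<in> K" for n x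
    using that
  proof (induction n arbitrary: x)
    case (Suc n)
    have "norm (Z n (Z n x)) \<le> ?y n * (?y n * norm x)"
      by (rule order_trans[OF Suc.IH[OF ZK]])
        (use Suc in \<open>auto intro: mult_left_mono sqrt_majorant_nonneg\<close>)
    then have "norm (X x + Z n (Z n x)) \<le> norm x + ?y n * (?y n * norm x)"
      using contr[OF Suc.prems] by (meson add_mono norm_triangle_le)
    then have "norm (Z (Suc n) x) \<le> (norm x + ?y n * (?y n * norm x)) / 2"
      unfolding ZS norm_scaleR by simp
    then show ?case by (simp add: power2_eq_square algebra_simps)
  qed (simp add: Z0)
  have Zstep: "norm (Z (Suc n) x - Z n x) \<le> (?y (Suc n) - ?y n) * norm x" if "x \<in> K" for n x
    using that
  proof (induction n arbitrary: x)
    case 0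
    then show ?case using contr by (simp add: Z0 ZS)
  next
    case (Suc n)
    let ?d = "?y (Suc n) - ?y n"
    have d: "0 \<le> ?d" using sqrt_majorant_mono[of n] by simp
    have 1: "norm (Z (Suc n) (Z (Suc n) x - Z n x)) \<le> ?y (Suc n) * (?d * norm x)"
      by (rule order_trans[OF Zbound])
        (intro csubspace_diff[OF cs] ZK Suc mult_left_mono sqrt_majorant_nonneg)+
    have 2: "norm (Z (Suc n) (Z n x) - Z n (Z n x)) \<le> ?d * (?y n * norm x)"
      by (rule order_trans[OF Suc.IH[OF ZK[OF Suc.prems]]])
        (intro mult_left_mono Zbound Suc.prems d)
    have "Z (Suc (Suc n)) x - Z (Suc n) x =
        (1/2) *\<^sub>R (X x + Z (Suc n) (Z (Suc n) x)) - (1/2) *\<^sub>R (X x + Z n (Z n x))"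
      by (simp only: ZS[of "Suc n" x] ZS[of n x])
    also have "\<dots> = (1/2) *\<^sub>R (Z (Suc n) (Z (Suc n) x) - Z n (Z n x))"
      by (simp only: scaleR_diff_right[symmetric] add_diff_cancel_left)
    also have "\<dots> =
        (1/2) *\<^sub>R (Z (Suc n) (Z (Suc n) x - Z n x) + (Z (Suc n) (Z n x) - Z n (Z n x)))"
      unfolding Zdiff[OF ZK[OF Suc.prems] ZK[OF Suc.prems]] by simp
    finally have "Z (Suc (Suc n)) x - Z (Suc n) x =
        (1/2) *\<^sub>R (Z (Suc n) (Z (Suc n) x - Z n x) + (Z (Suc n) (Z n x) - Z n (Z n x)))" .
    then have "norm (Z (Suc (Suc n)) x - Z (Suc n) x) \<le>
        (?y (Suc n) * (?d * norm x) + ?d * (?y n * norm x)) / 2"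
      using norm_triangle_mono[OF 1 2] by simp
    also have "\<dots> = (?y (Suc (Suc n)) - ?y (Suc n)) * norm x"
      unfolding sqrt_majorant_Suc_diff by (simp add: algebra_simps)
    finally show ?case .
  qed
  have Zdist: "norm (Z (n + k) x - Z n x) \<le> (?y (n + k) - ?y n) * norm x" if "x \<in> K" for n k x
  proof (induction k)
    case (Suc k)
    have "norm (Z (n + Suc k) x - Z n x) \<le>
        norm (Z (Suc (n + k)) x - Z (n + k) x) + norm (Z (n + k) x - Z n x)"
      using norm_triangle_ineq[of "Z (Suc (n + k)) x - Z (n + k) x" "Z (n + k) x - Z n x"] by simp
    then show ?case
      using Zstep[OF that, of "n + k"] Suc by (simp add: algebra_simps)
  qed simp
  have "Cauchy (\<lambda>n. Z n x)" if x: "x \<in> K" for x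
  proof (rule CauchyI')
    fix e :: real assume e: "e > 0"
    define e' where "e' = e / (norm x + 1)"
    have "e' > 0" using e by (simp add: e'_def add_nonneg_pos)
    then obtain N where N: "\<And>m n. m \<ge> N \<Longrightarrow> n \<ge> N \<Longrightarrow> norm (?y m - ?y n) < e'"
      using CauchyD[OF sqrt_majorant_Cauchy] by blast
    have "norm (Z m x - Z n x) < e" if "m \<ge> N" "n > m" for m n
    proof -
      obtain k where k: "n = m + k" using \<open>n > m\<close> less_imp_add_positive by blast
      have "norm (Z m x - Z n x) \<le> (?y n - ?y m) * norm x"
        using Zdist[OF x, of m k] by (simp add: k norm_minus_commute)
      also have "\<dots> \<le> e' * norm x"
        using N[of n m] that by (intro mult_right_mono) auto
      also have "\<dots> < e' * (norm x + 1)"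
        using \<open>e' > 0\<close> by simp
      also have "\<dots> = e"
        using norm_ge_zero[of x] by (simp add: e'_def add_nonneg_eq_0_iff)
      finally show ?thesis .
    qed
    then show "\<exists>M. \<forall>m\<ge>M. \<forall>n>m. dist (Z m x) (Z n x) < e"
      unfolding dist_norm by blast
  qed
  then have "\<exists>l. (\<lambda>n. Z n x) \<longlonglongrightarrow> l" if "x \<in> K" for x
    using that Cauchy_convergent convergent_def by blast
  then obtain Y where Y: "\<And>x. x \<in> K \<Longrightarrow> (\<lambda>n. Z n x) \<longlonglongrightarrow> Y x" by metis
  have YK: "Y x \<in> K" if "x \<in> K" for x
    using closed_sequentially[OF cl _ Y[OF that]] ZK[OF that] by blast
  have Zcontr: "norm (Z n x) \<le> norm x" if "x \<in> K" for n x
    using Zbound[OF that, of n] mult_right_mono[OF sqrt_majorant_le_1[of n], of "norm x"] by simp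
  have Yop: "Y \<in> bounded_ops K"
  proof (rule bounded_opsI[where B = 1])
    fix x y c assume x: "x \<in> K"
    show "Y x \<in> K" by (rule YK[OF x])
    show "norm (Y x) \<le> 1 * norm x"
      using Lim_norm_ubound[OF _ Y[OF x]] Zcontr[OF x] by simp
    show "Y (x + y) = Y x + Y y" if y: "y \<in> K"
      by (rule LIMSEQ_unique[OF Y[OF csubspace_add[OF cs x y]]])
        (simp add: Zadd x y tendsto_add Y)
    show "Y (c *\<^sub>C x) = c *\<^sub>C Y x"
      by (rule LIMSEQ_unique[OF Y[OF csubspace_scaleC[OF cs x]]])
        (simp add: Zscale x bounded_linear.tendsto[OF bounded_linear_scaleC Y])
  qed
  have cont: "(\<lambda>n. cinner (f n) y) \<longlonglongrightarrow> cinner l y" if "f \<longlonglongrightarrow> l" for f and l y :: 'a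
  proof (rule Lim_null[THEN iffD2], rule Lim_null_comparison)
    show "\<forall>\<^sub>F n in sequentially. norm (cinner (f n) y - cinner l y) \<le> norm (f n - l) * norm y"
      by (simp add: cinner_diff_left[symmetric] norm_cinner_le)
    show "(\<lambda>n. norm (f n - l) * norm y) \<longlonglongrightarrow> 0"
      using tendsto_mult_left_zero[OF tendsto_norm_zero[OF LIM_zero[OF that]]] .
  qed
  have Ysym: "cinner (Y x) y = cinner x (Y y)" if x: "x \<in> K" and y: "y \<in> K" for x y
  proof (rule LIMSEQ_unique[OF cont[OF Y[OF x]]])
    have "(\<lambda>n. cnj (cinner (Z n y) x)) \<longlonglongrightarrow> cnj (cinner (Y y) x)"
      by (intro tendsto_cnj cont Y y)
    then show "(\<lambda>n. cinner (Z n x) y) \<longlonglongrightarrow> cinner x (Y y)"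
      by (simp add: Zsym[OF x y] cinner_commute[symmetric])
  qed
  have Yeq: "2 *\<^sub>R Y x = X x + Y (Y x)" if x: "x \<in> K" for x
  proof (rule LIMSEQ_unique)
    have "(\<lambda>n. 2 *\<^sub>R Z (Suc n) x) \<longlonglongrightarrow> 2 *\<^sub>R Y x"
      by (intro tendsto_intros LIMSEQ_Suc Y x)
    then show "(\<lambda>n. X x + Z n (Z n x)) \<longlonglongrightarrow> 2 *\<^sub>R Y x" by (simp add: ZS)
    have "(\<lambda>n. Z n (Z n x - Y x)) \<longlonglongrightarrow> 0"
    proof (rule Lim_null_comparison)
      show "\<forall>\<^sub>F n in sequentially. norm (Z n (Z n x - Y x)) \<le> norm (Z n x - Y x)"
        by (intro always_eventually allI Zcontr csubspace_diff[OF cs] ZK YK x)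
      show "(\<lambda>n. norm (Z n x - Y x)) \<longlonglongrightarrow> 0"
        by (intro tendsto_norm_zero LIM_zero Y x)
    qed
    from tendsto_add[OF this Y[OF YK[OF x]]]
    have "(\<lambda>n. Z n (Z n x)) \<longlonglongrightarrow> Y (Y x)"
      by (simp add: Zdiff ZK YK x)
    then show "(\<lambda>n. X x + Z n (Z n x)) \<longlonglongrightarrow> X x + Y (Y x)"
      by (intro tendsto_intros)
  qed
  show thesis using that Yop Ysym Yeq by blast
qed

text \<open>If \<open>\<parallel>P\<parallel> \<le> B\<close>, then \<open>X = 1 - P / B\<close> is a self-adjoint contraction, and \<open>1 - X = P / B\<close>.\<close>

lemma positive_sqrt_exists:
  fixes K :: "'a::chilbert_space set"
  assumes K: "hilbert_subspace K" and P: "P \<in> bounded_ops K" and pos: "positive_on K P"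
  obtains R where "R \<in> bounded_ops K"
    "\<And>x. x \<in> K \<Longrightarrow> R (R x) = P x"
    "\<And>x. x \<in> K \<Longrightarrow> (norm (R x))\<^sup>2 = Re (cinner (P x) x)"
proof -
  have cs: "csubspace K" using K by (simp add: hilbert_subspace_def)
  obtain B where B: "B > 0" "\<And>x. x \<in> K \<Longrightarrow> norm (P x) \<le> B * norm x"
    using bounded_ops_bound[OF P] by blast
  define c where "c = inverse B"
  have c: "c > 0" "c * B = 1" using B(1) by (auto simp: c_def)
  note PK = bounded_ops_in[OF P]
  note Psym = positive_on_symmetric[OF cs P pos]
  have cP: "(\<lambda>x. c *\<^sub>R P x) \<in> bounded_ops K"
    using bounded_ops_scaled[OF P cs, of c] by simp
  have X: "(\<lambda>x. x - c *\<^sub>R P x) \<in> bounded_ops K"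
    using bounded_ops_scaled_diff[OF bounded_ops_ident cP cs, of 1] by simp
  obtain Y where Y: "Y \<in> bounded_ops K"
    and Ysym: "\<And>x y. x \<in> K \<Longrightarrow> y \<in> K \<Longrightarrow> cinner (Y x) y = cinner x (Y y)"
    and Yeq: "\<And>x. x \<in> K \<Longrightarrow> 2 *\<^sub>R Y x = (x - c *\<^sub>R P x) + Y (Y x)"
  proof (rule sqrt_of_one_minus[OF K X])
    fix x assume x: "x \<in> K"
    have "(norm (x - c *\<^sub>R P x))\<^sup>2 \<le> (norm x)\<^sup>2 - c * Re (cinner (P x) x)"
      unfolding c_def by (rule positive_on_damped_step[OF cs P pos B x])
    also have "\<dots> \<le> (norm x)\<^sup>2"
      using mult_nonneg_nonneg[OF less_imp_le[OF c(1)] positive_onD(1)[OF pos x]] by simp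
    finally show "norm (x - c *\<^sub>R P x) \<le> norm x" by (rule power2_le_imp_le) simp
  next
    fix x y assume "x \<in> K" "y \<in> K"
    then show "cinner (x - c *\<^sub>R P x) y = cinner x (y - c *\<^sub>R P y)"
      by (simp add: cinner_simps Psym)
  qed blast
  define R where "R x = sqrt B *\<^sub>R (x - Y x)" for x
  have R: "R \<in> bounded_ops K"
    unfolding R_def by (rule bounded_ops_scaled_diff[OF bounded_ops_ident Y cs])
  have RR: "R (R x) = P x" if x: "x \<in> K" for x
  proof -
    have xY: "x - Y x \<in> K" by (intro csubspace_intros cs x bounded_ops_in[OF Y])
    have "R (R x) = B *\<^sub>R ((x - Y x) - Y (x - Y x))"
      using B(1) by (simp add: R_def bounded_ops_scaleR[OF Y xY] scaleR_diff_right[symmetric])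
    also have "(x - Y x) - Y (x - Y x) = x - 2 *\<^sub>R Y x + Y (Y x)"
      by (simp add: bounded_ops_diff[OF Y cs x bounded_ops_in[OF Y x]] scaleR_2)
    also have "\<dots> = c *\<^sub>R P x" by (simp add: Yeq[OF x])
    finally show ?thesis using c by (simp add: mult.commute)
  qed
  have "(norm (R x))\<^sup>2 = Re (cinner (P x) x)" if x: "x \<in> K" for x
  proof -
    have "cinner (R y) z = cinner y (R z)" if "y \<in> K" "z \<in> K" for y z
      by (simp add: R_def cinner_simps Ysym that)
    from this[OF bounded_ops_in[OF R x] x] show ?thesis
      by (simp add: RR[OF x] Re_cinner_self)
  qed
  then show thesis using that R RR by blast
qed

section \<open>Similarity of quasi-isometries to isometries\<close>

text \<open>A coercive \<open>P = R\<^sup>2\<close> is onto, because \<open>P x = y\<close> is the fixed point equation of the strict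
  contraction \<open>x \<mapsto> x - c (P x - y)\<close> for small \<open>c\<close>. Then so is \<open>R\<close>, and the lower bound makes the
  inverse bounded.\<close>

lemma sqrt_coercive_invertible:
  fixes K :: "'a::chilbert_space set"
  assumes K: "hilbert_subspace K" and P: "P \<in> bounded_ops K" and pos: "positive_on K P"
    and R: "R \<in> bounded_ops K" and RR: "\<And>x. x \<in> K \<Longrightarrow> R (R x) = P x"
    and R2: "\<And>x. x \<in> K \<Longrightarrow> (norm (R x))\<^sup>2 = Re (cinner (P x) x)"
    and d: "d > 0" "\<And>x. x \<in> K \<Longrightarrow> d * norm x \<le> norm (R x)"
  shows "invertible_on K R"
proof -
  have cs: "csubspace K" and cl: "closed K" using K by (auto simp: hilbert_subspace_def)
  obtain B0 where B0: "B0 > 0" "\<And>x. x \<in> K \<Longrightarrow> norm (P x) \<le> B0 * norm x"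
    using bounded_ops_bound[OF P] by blast
  \<comment> \<open>Enlarging the bound by \<open>d\<^sup>2\<close> keeps the square of the contraction factor nonnegative even if \<open>K\<close>
    is trivial.\<close>
  define B where "B = B0 + d\<^sup>2"
  have B: "B > 0" "B > d\<^sup>2" using B0 d by (auto simp: B_def add_pos_pos)
  have BP: "norm (P x) \<le> B * norm x" if "x \<in> K" for x
    using B0(2)[OF that] by (simp add: B_def algebra_simps add_increasing2)
  define c where "c = inverse B"
  have c: "c > 0" "c * B = 1" using B(1) by (auto simp: c_def)
  define q where "q = sqrt (1 - c * d\<^sup>2)"
  have cd: "0 \<le> 1 - c * d\<^sup>2" "c * d\<^sup>2 > 0"
    using B d by (auto simp: c_def field_simps)
  have q: "0 \<le> q" "q < 1" "q\<^sup>2 = 1 - c * d\<^sup>2"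
    using cd by (auto simp: q_def)
  note PK = bounded_ops_in[OF P]
  note Psym = positive_on_symmetric[OF cs P pos]
  have contr: "norm (x - c *\<^sub>R P x) \<le> q * norm x" if x: "x \<in> K" for x
  proof -
    have "(norm (x - c *\<^sub>R P x))\<^sup>2 \<le> (norm x)\<^sup>2 - c * (norm (R x))\<^sup>2"
      using positive_on_damped_step[OF cs P pos B(1) BP x] by (simp add: c_def R2[OF x])
    moreover have "c * (d * norm x)\<^sup>2 \<le> c * (norm (R x))\<^sup>2"
      using c d by (intro mult_left_mono power_mono d(2) x) auto
    ultimately have "(norm (x - c *\<^sub>R P x))\<^sup>2 \<le> (norm x)\<^sup>2 - c * (d * norm x)\<^sup>2"
      by linarith
    also have "\<dots> = (q * norm x)\<^sup>2"
      by (simp add: power_mult_distrib q algebra_simps)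
    finally have "(norm (x - c *\<^sub>R P x))\<^sup>2 \<le> (q * norm x)\<^sup>2" .
    then show ?thesis by (rule power2_le_imp_le) (simp add: q)
  qed
  have surj: "\<exists>x\<in>K. P x = y" if y: "y \<in> K" for y
  proof -
    define f where "f x = x - c *\<^sub>R P x + c *\<^sub>R y" for x
    have "\<exists>!x\<in>K. f x = x"
    proof (rule Banach_fix)
      show "complete K" using cl by (simp add: complete_eq_closed)
      show "K \<noteq> {}" using y by blast
      show "0 \<le> q" "q < 1" by (fact q)+
      show "f ` K \<subseteq> K"
        unfolding f_def by (auto intro!: csubspace_intros[OF cs] PK y)
      fix x z assume x: "x \<in> K" and z: "z \<in> K"
      have "f x - f z = (x - z) - c *\<^sub>R P (x - z)"
        by (simp add: f_def bounded_ops_diff[OF P cs x z] algebra_simps)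
      then show "dist (f x) (f z) \<le> q * dist x z"
        using contr[OF csubspace_diff[OF cs x z]] by (simp add: dist_norm)
    qed
    then obtain x where x: "x \<in> K" "f x = x" by blast
    have "c *\<^sub>R (P x - y) = x - f x" by (simp add: f_def scaleR_diff_right)
    then have "c *\<^sub>R (P x - y) = 0" using x(2) by simp
    then have "P x = y" using c(1) by simp
    then show ?thesis using x(1) by blast
  qed
  have "\<exists>x\<in>K. R x = y" if "y \<in> K" for y
    using surj[OF that] RR bounded_ops_in[OF R] by metis
  then obtain M where MK: "\<And>y. y \<in> K \<Longrightarrow> M y \<in> K" and RM: "\<And>y. y \<in> K \<Longrightarrow> R (M y) = y"
    by metis
  have inj: "x = y" if "x \<in> K" "y \<in> K" "R x = R y" for x y
    using d(2)[OF csubspace_diff[OF cs that(1,2)]] d(1)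
    by (simp add: bounded_ops_diff[OF R cs] that mult_le_0_iff)
  have "M \<in> bounded_ops K"
  proof (rule bounded_opsI[where B = "inverse d"])
    fix x y c assume x: "x \<in> K"
    show "M x \<in> K" by (rule MK[OF x])
    show "M (x + y) = M x + M y" if y: "y \<in> K"
      by (rule inj) (simp_all add: csubspace_add[OF cs] MK RM x y bounded_ops_add[OF R])
    show "M (c *\<^sub>C x) = c *\<^sub>C M x"
      by (rule inj) (simp_all add: csubspace_scaleC[OF cs] MK RM x bounded_ops_scaleC[OF R])
    show "norm (M x) \<le> inverse d * norm x"
      using d(2)[OF MK[OF x]] d(1) by (simp add: RM[OF x] field_simps)
  qed
  moreover have "M (R x) = x" if "x \<in> K" for x
    by (rule inj) (simp_all add: bounded_ops_in[OF R] MK RM that)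
  ultimately show ?thesis
    unfolding invertible_on_def inverse_ops_on_def using R RM by blast
qed

text \<open>The norm \<open>\<parallel>S x\<parallel>\<close> is equivalent to the given one and invariant under \<open>S\<close>. With \<open>R = sqrt (S\<^sup>* S)\<close>
  it is \<open>\<parallel>R x\<parallel>\<close>, so \<open>R\<close> carries \<open>S\<close> to an operator that preserves the original norm of \<open>K\<close>.\<close>

lemma quasi_isometric_similar_to_isometry:
  fixes K :: "'a::chilbert_space set"
  assumes K: "hilbert_subspace K" and S: "S \<in> bounded_ops K"
    and eq: "\<And>x. x \<in> K \<Longrightarrow> norm (S (S x)) = norm (S x)"
    and d: "d > 0" "\<And>x. x \<in> K \<Longrightarrow> d * norm x \<le> norm (S x)"
  shows "similar_to_isometry K S"
proof -
  define P where "P x = adjoint_on K S (S x)" for x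
  have P: "P \<in> bounded_ops K"
    unfolding P_def by (rule bounded_ops_comp[OF adjoint_on_bounded_ops[OF K S] S])
  have PS: "cinner (P x) x = complex_of_real ((norm (S x))\<^sup>2)" if "x \<in> K" for x
  proof -
    have "cinner x (P x) = cinner (S x) (S x)"
      by (simp add: P_def cinner_adjoint_on[OF K S that])
    then have "cnj (cinner x (P x)) = complex_of_real ((norm (S x))\<^sup>2)"
      by (simp add: cinner_self)
    then show ?thesis by (simp only: cinner_commute[of "P x" x])
  qed
  have pos: "positive_on K P"
    by (auto simp: positive_on_def PS complex_nonneg_Reals_iff)
  obtain R where R: "R \<in> bounded_ops K" "\<And>x. x \<in> K \<Longrightarrow> R (R x) = P x"
    and R2: "\<And>x. x \<in> K \<Longrightarrow> (norm (R x))\<^sup>2 = Re (cinner (P x) x)"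
    using positive_sqrt_exists[OF K P pos] by blast
  have nR: "norm (R x) = norm (S x)" if "x \<in> K" for x
    using R2[OF that] by (simp add: PS[OF that] power2_eq_iff_nonneg)
  have "invertible_on K R"
    using sqrt_coercive_invertible[OF K P pos R R2 d(1)] d(2) nR by simp
  then obtain M where M: "inverse_ops_on K R M" by (auto simp: invertible_on_def)
  then have Mop: "M \<in> bounded_ops K"
    and RM: "\<And>x. x \<in> K \<Longrightarrow> R (M x) = x" and MR: "\<And>x. x \<in> K \<Longrightarrow> M (R x) = x"
    by (auto simp: inverse_ops_on_def)
  have "isometry_on K (\<lambda>x. R (S (M x)))"
    unfolding isometry_on_def
  proof (intro conjI ballI)
    show "(\<lambda>x. R (S (M x))) \<in> bounded_ops K"
      by (rule bounded_ops_comp[OF R(1) bounded_ops_comp[OF S Mop]])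
    fix x assume x: "x \<in> K"
    have Mx: "M x \<in> K" by (rule bounded_ops_in[OF Mop x])
    have "norm (R (S (M x))) = norm (R (M x))"
      by (simp add: nR eq Mx bounded_ops_in[OF S])
    then show "norm (R (S (M x))) = norm x" by (simp add: RM x)
  qed
  then show ?thesis
    unfolding similar_to_isometry_def using M
    by (intro exI[of _ "\<lambda>x. R (S (M x))"] exI[of _ R] exI[of _ M])
      (auto simp: MR bounded_ops_in[OF S])
qed

section \<open>Restriction to the closed span of an orbit\<close>

lemma bounded_ops_bounded_linear:
  assumes S: "S \<in> bounded_ops UNIV"
  shows "bounded_linear S"
proof -
  obtain B where "B > 0" and B: "\<And>x. norm (S x) \<le> B * norm x"
    using bounded_ops_bound[OF S] by (metis UNIV_I)
  show ?thesis
  proof (rule bounded_linear_intro[where K = B])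
    fix x y r
    show "S (x + y) = S x + S y" by (rule bounded_ops_add[OF S]) simp_all
    show "S (r *\<^sub>R x) = r *\<^sub>R S x" by (rule bounded_ops_scaleR[OF S]) simp
    show "norm (S x) \<le> norm x * B" using B[of x] by (simp only: mult.commute)
  qed
qed

lemma bounded_ops_subspace:
  assumes S: "S \<in> bounded_ops UNIV" and inv: "\<And>x. x \<in> K \<Longrightarrow> S x \<in> K"
  shows "S \<in> bounded_ops K"
  using assms unfolding bounded_ops_def by auto

text \<open>Minimality comes for free: the lifting equation, the norm equation of quasi-isometry and the lower
  bound all survive restriction to the smallest closed invariant subspace containing \<open>H\<close>.\<close>

lemma orbit_closed_span:
  fixes S :: "'a::chilbert_space \<Rightarrow> 'a" and H :: "'a set"
  assumes S: "S \<in> bounded_ops UNIV"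
  defines "K \<equiv> closure (cspan (\<Union>n. (S ^^ n) ` H))"
  shows hilbert_subspace_orbit: "hilbert_subspace K"
    and orbit_superset: "H \<subseteq> K"
    and orbit_invariant: "S \<in> bounded_ops K"
proof -
  let ?U = "\<Union>n. (S ^^ n) ` H"
  show "hilbert_subspace K"
    by (simp add: hilbert_subspace_def K_def csubspace_closure)
  have "H \<subseteq> ?U" by (auto intro: UN_I[of 0])
  also have "?U \<subseteq> K"
    unfolding K_def using complex_vector.span_superset closure_subset by (rule order_trans)
  finally show "H \<subseteq> K" .
  have U: "S x \<in> ?U" if x: "x \<in> ?U" for x
  proof -
    obtain n h where "h \<in> H" "x = (S ^^ n) h" using x by auto
    then have "S x = (S ^^ Suc n) h" by simp
    then show ?thesis using \<open>h \<in> H\<close> by blast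
  qed
  have span: "S x \<in> cspan ?U" if "x \<in> cspan ?U" for x
    using that
  proof (induction rule: complex_vector.span_induct_alt)
    case base
    have "S 0 = 0" using bounded_ops_scaleR[OF S, of 0 0] by simp
    then show ?case by (simp add: complex_vector.span_zero)
  next
    case (step c x y)
    have "S (c *\<^sub>C x + y) = c *\<^sub>C S x + S y"
      by (simp add: bounded_ops_add[OF S] bounded_ops_scaleC[OF S])
    also have "\<dots> \<in> cspan ?U"
      using step complex_vector.span_base[OF U]
      by (intro complex_vector.span_add complex_vector.span_scale) simp_all
    finally show ?case .
  qed
  have "S ` closure (cspan ?U) \<subseteq> closure (S ` cspan ?U)"
    by (rule image_closure_subset)
      (auto intro: closure_subset[THEN subsetD] linear_continuous_on
        bounded_ops_bounded_linear[OF S])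
  also have "\<dots> \<subseteq> closure (cspan ?U)"
    by (rule closure_mono) (use span in auto)
  finally have "S x \<in> K" if "x \<in> K" for x using that unfolding K_def by blast
  then show "S \<in> bounded_ops K" by (rule bounded_ops_subspace[OF S])
qed

section \<open>The lifting on square-summable sequences\<close>

lemma ell2_eqI: "(\<And>n. ell2_nth x n = ell2_nth y n) \<Longrightarrow> x = y"
  by (metis ell2_nth_inject ext)

definition ell2_tail :: "'a::chilbert_space ell2 \<Rightarrow> real" where
  "ell2_tail x = (\<Sum>n. (norm (ell2_nth x (n + 2)))\<^sup>2)"

lemma ell2_tail_nonneg: "0 \<le> ell2_tail x"
  unfolding ell2_tail_def
  by (intro suminf_nonneg summable_ignore_initial_segment summable_ell2_nth) simp

lemma norm_ell2_split:
  "(norm x)\<^sup>2 = (norm (ell2_nth x 0))\<^sup>2 + (norm (ell2_nth x 1))\<^sup>2 + ell2_tail x"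
  unfolding norm_ell2_eq ell2_tail_def
  by (subst suminf_split_initial_segment[OF summable_ell2_nth, of _ 2])
    (simp add: numeral_2_eq_2)

lift_definition ell2_embed :: "'a::chilbert_space \<Rightarrow> 'a ell2" is "\<lambda>h n. if n = 0 then h else 0"
  subgoal for h
    by (rule summable_finite[of "{0}"]) auto
  done

lemma ell2_tail_embed: "ell2_tail (ell2_embed h) = 0"
  by (simp add: ell2_tail_def ell2_embed.rep_eq)

lemma norm_ell2_embed: "norm (ell2_embed h) = norm h"
proof -
  have "(norm (ell2_embed h))\<^sup>2 = (norm h)\<^sup>2"
    by (simp add: norm_ell2_split ell2_tail_embed ell2_embed.rep_eq)
  then show ?thesis by (simp add: power2_eq_iff_nonneg)
qed

lemma clinear_ell2_embed: "clinear ell2_embed"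
  by unfold_locales
    (auto intro!: ell2_eqI simp: ell2_embed.rep_eq plus_ell2.rep_eq scaleC_ell2.rep_eq)

lemma cinner_ell2_embed: "cinner x (ell2_embed g) = cinner (ell2_nth x 0) g"
proof -
  have "cinner x (ell2_embed g) = (\<Sum>n\<in>{0}. cinner (ell2_nth x n) (ell2_nth (ell2_embed g) n))"
    unfolding cinner_ell2_def by (rule suminf_finite) (auto simp: ell2_embed.rep_eq)
  then show ?thesis by (simp add: ell2_embed.rep_eq)
qed

lemma orth_proj_ell2_embed: "orth_proj ell2_embed x = ell2_nth x 0"
  unfolding orth_proj_def
proof (rule the_equality)
  show "\<forall>g. cinner (x - ell2_embed (ell2_nth x 0)) (ell2_embed g) = 0"
    by (simp add: cinner_ell2_embed minus_ell2.rep_eq ell2_embed.rep_eq)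
  fix h assume "\<forall>g. cinner (x - ell2_embed h) (ell2_embed g) = 0"
  then have "cinner (ell2_nth x 0 - h) (ell2_nth x 0 - h) = 0"
    by (simp add: cinner_ell2_embed minus_ell2.rep_eq ell2_embed.rep_eq)
  then show "h = ell2_nth x 0" by (simp add: cinner_self)
qed

text \<open>Write \<open>h = x 0\<close> and measure it in the square norm \<open>\<parallel>h\<parallel>\<^sup>2 + \<parallel>E h\<parallel>\<^sup>2\<close>, in which \<open>T\<close> is to be a
  contraction with defect operator \<open>D\<close>. In the coordinate \<open>x 1 - E h\<close> instead of \<open>x 1\<close> this operator is
  an isometric lifting of that contraction: the image has the entry 0 in position 1 and the defect \<open>D h\<close>
  in position 2, and all entries from position 1 on move by two places. The shift by two places rather
  than one keeps position 1 free in the image, so that changing the norm there does not disturb it.\<close>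

lift_definition quasi_isometric_lift ::
    "('a \<Rightarrow> 'a) \<Rightarrow> ('a \<Rightarrow> 'a) \<Rightarrow> ('a \<Rightarrow> 'a) \<Rightarrow> 'a::chilbert_space ell2 \<Rightarrow> 'a ell2"
  is "\<lambda>T E D x n. if n = 0 then T (x 0) else if n = 1 then E (T (x 0)) else if n = 2 then D (x 0)
        else if n = 3 then x 1 - E (x 0) else x (n - 2)"
  subgoal premises prems for T E D x
  proof -
    have "summable (\<lambda>n. (norm (x (n + 2)))\<^sup>2)"
      by (rule summable_ignore_initial_segment[OF prems])
    then show ?thesis
      by (subst summable_iff_shift[of _ 4, symmetric]) (simp add: numeral_eq_Suc)
  qed
  done

lemma norm_add_square_le:
  fixes u v :: "'a::real_inner"
  shows "(norm (u + v))\<^sup>2 \<le> 2 * (norm u)\<^sup>2 + 2 * (norm v)\<^sup>2"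
proof -
  have "(norm (u + v))\<^sup>2 + (norm (u - v))\<^sup>2 = 2 * (norm u)\<^sup>2 + 2 * (norm v)\<^sup>2"
    by (simp add: power2_norm_eq_inner algebra_simps inner_commute)
  then show ?thesis using zero_le_power2[of "norm (u - v)"] by linarith
qed

text \<open>The identity says \<open>D\<^sup>* D = A - T\<^sup>* A T\<close> for \<open>A = 1 + E\<^sup>* E\<close>.\<close>

locale lifting_data =
  fixes T E D :: "'a::chilbert_space \<Rightarrow> 'a"
  assumes T: "T \<in> bounded_ops UNIV" and E: "E \<in> bounded_ops UNIV" and D: "D \<in> bounded_ops UNIV"
    and defect: "(norm (T g))\<^sup>2 + (norm (E (T g)))\<^sup>2 + (norm (D g))\<^sup>2 = (norm g)\<^sup>2 + (norm (E g))\<^sup>2"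
begin

abbreviation "S \<equiv> quasi_isometric_lift T E D"

lemma ell2_tail_lift:
  "ell2_tail (S x) = (norm (D (ell2_nth x 0)))\<^sup>2
      + (norm (ell2_nth x 1 - E (ell2_nth x 0)))\<^sup>2 + ell2_tail x"
proof -
  have "summable (\<lambda>n. (norm (ell2_nth (S x) (n + 2)))\<^sup>2)"
    by (rule summable_ignore_initial_segment[OF summable_ell2_nth])
  from suminf_split_initial_segment[OF this, of 2] show ?thesis
    by (simp add: ell2_tail_def quasi_isometric_lift.rep_eq numeral_2_eq_2 numeral_3_eq_3)
qed

text \<open>The right side is a square norm that \<open>S\<close> leaves invariant: it equals \<open>\<parallel>x\<parallel>\<^sup>2\<close> whenever \<open>x 1 = E (x 0)\<close>,
  as holds on the range of \<open>S\<close>.\<close>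

lemma norm_lift:
  "(norm (S x))\<^sup>2 = (norm (ell2_nth x 0))\<^sup>2 + (norm (E (ell2_nth x 0)))\<^sup>2
      + (norm (ell2_nth x 1 - E (ell2_nth x 0)))\<^sup>2 + ell2_tail x"
  using defect[of "ell2_nth x 0"]
  by (simp add: norm_ell2_split ell2_tail_lift quasi_isometric_lift.rep_eq)

lemma norm_lift_lift: "norm (S (S x)) = norm (S x)"
proof -
  have "(norm (S (S x)))\<^sup>2 = (norm (S x))\<^sup>2"
    unfolding norm_lift[of "S x"] ell2_tail_lift using defect[of "ell2_nth x 0"]
    by (simp add: norm_lift quasi_isometric_lift.rep_eq)
  then show ?thesis by (simp add: power2_eq_iff_nonneg)
qed

lemma lift_bounded_below: "(1/2) * norm x \<le> norm (S x)"
proof (rule power2_le_imp_le)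
  let ?a = "ell2_nth x 0" and ?b = "ell2_nth x 1"
  have "(norm ?b)\<^sup>2 \<le> 2 * (norm (?b - E ?a))\<^sup>2 + 2 * (norm (E ?a))\<^sup>2"
    using norm_add_square_le[of "?b - E ?a" "E ?a"] by simp
  then have "(norm x)\<^sup>2 \<le> 2 * (norm (S x))\<^sup>2"
    using norm_lift[of x] norm_ell2_split[of x] ell2_tail_nonneg[of x] zero_le_power2[of "norm ?a"]
    by linarith
  moreover have "((1/2) * norm x)\<^sup>2 = (norm x)\<^sup>2 / 4"
    by (simp add: power_divide)
  ultimately show "((1/2) * norm x)\<^sup>2 \<le> (norm (S x))\<^sup>2"
    using zero_le_power2[of "norm (S x)"] by linarith
qed simp

lemma lift_bounded_ops: "S \<in> bounded_ops UNIV"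
proof -
  obtain b where b: "b > 0" "\<And>x. norm (E x) \<le> b * norm x"
    using bounded_ops_bound[OF E] by (metis UNIV_I)
  show ?thesis
  proof (rule bounded_opsI)
    fix x y :: "'a ell2" and c
    show "S (x + y) = S x + S y"
      by (rule ell2_eqI)
        (simp add: quasi_isometric_lift.rep_eq plus_ell2.rep_eq bounded_opsD[OF T]
          bounded_opsD[OF E] bounded_opsD[OF D])
    show "S (c *\<^sub>C x) = c *\<^sub>C S x"
      by (rule ell2_eqI)
        (simp add: quasi_isometric_lift.rep_eq scaleC_ell2.rep_eq bounded_opsD[OF T]
          bounded_opsD[OF E] bounded_opsD[OF D] complex_vector.scale_right_diff_distrib)
    let ?a = "ell2_nth x 0" and ?b = "ell2_nth x 1"
    have "(norm (?b - E ?a))\<^sup>2 \<le> 2 * (norm ?b)\<^sup>2 + 2 * (norm (E ?a))\<^sup>2"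
      using norm_add_square_le[of ?b "- E ?a"] by simp
    moreover have "(norm (E ?a))\<^sup>2 \<le> b\<^sup>2 * (norm ?a)\<^sup>2"
      using power_mono[OF b(2), of ?a 2] by (simp add: power_mult_distrib)
    ultimately have "(norm (S x))\<^sup>2 \<le> (norm ?a)\<^sup>2 + 2 * (norm ?b)\<^sup>2 + ell2_tail x + 3 * (b\<^sup>2 * (norm ?a)\<^sup>2)"
      using norm_lift[of x] by linarith
    also have "\<dots> \<le> 2 * (norm x)\<^sup>2 + 3 * (b\<^sup>2 * (norm x)\<^sup>2)"
    proof -
      have "b\<^sup>2 * (norm ?a)\<^sup>2 \<le> b\<^sup>2 * (norm x)\<^sup>2"
        by (intro mult_left_mono power_mono norm_ell2_nth_le) auto
      then show ?thesis
        using ell2_tail_nonneg[of x] zero_le_power2[of "norm ?a"] norm_ell2_split[of x]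
        by linarith
    qed
    also have "\<dots> = (2 + 3 * b\<^sup>2) * (norm x)\<^sup>2"
      by (simp add: distrib_right)
    also have "\<dots> = (sqrt (2 + 3 * b\<^sup>2) * norm x)\<^sup>2"
      by (simp add: power_mult_distrib)
    finally show "norm (S x) \<le> sqrt (2 + 3 * b\<^sup>2) * norm x"
      by (rule power2_le_imp_le) simp
  qed simp
qed

end

section \<open>Existence of the lifting\<close>

text \<open>An invertible positive \<open>A\<close> is bounded below, so a multiple \<open>s A\<close> dominates the identity, and
  scaling keeps \<open>T\<^sup>* A T \<le> A\<close>. Take the roots of \<open>s A - 1\<close> and of \<open>s (A - T\<^sup>* A T)\<close>.\<close>

lemma lifting_data_exists:
  fixes T :: "'h::chilbert_space \<Rightarrow> 'h"
  assumes T: "T \<in> bounded_ops UNIV" and sim: "similar_to_contraction UNIV T"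
  obtains E D where "lifting_data T E D"
proof -
  obtain A A' where A: "A \<in> bounded_ops UNIV" and pos: "positive_on UNIV A"
    and le: "op_le_on UNIV (adjoint_on UNIV T \<circ> A \<circ> T) A"
    and A': "A' \<in> bounded_ops UNIV" "\<And>x. A' (A x) = x"
    using sim by (auto simp: similar_to_contraction_def invertible_on_def inverse_ops_on_def)
  have H: "hilbert_subspace UNIV" by (rule hilbert_subspace_UNIV)
  obtain B where B: "B > 0" "\<And>x. norm (A x) \<le> B * norm x"
    using bounded_ops_bound[OF A] by (metis UNIV_I)
  obtain C where C: "C > 0" "\<And>x. norm (A' x) \<le> C * norm x"
    using bounded_ops_bound[OF A'(1)] by (metis UNIV_I)
  \<comment> \<open>From \<open>\<parallel>x\<parallel> \<le> C \<parallel>A x\<parallel>\<close> and \<open>A\<^sup>2 \<le> B A\<close>.\<close>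
  define s where "s = C\<^sup>2 * B"
  have s: "s > 0" using B C by (simp add: s_def)
  have low: "(norm x)\<^sup>2 \<le> s * Re (cinner (A x) x)" for x
  proof -
    have "norm x \<le> C * norm (A x)" using C(2)[of "A x"] by (simp add: A')
    then have "(norm x)\<^sup>2 \<le> C\<^sup>2 * (norm (A x))\<^sup>2"
      using power_mono[of "norm x" "C * norm (A x)" 2] by (simp add: power_mult_distrib)
    also have "\<dots> \<le> C\<^sup>2 * (B * Re (cinner (A x) x))"
      by (intro mult_left_mono positive_on_norm_bound[OF _ A pos B]) auto
    finally show ?thesis by (simp add: s_def mult.assoc)
  qed
  have AI: "Im (cinner (A x) x) = 0" for x
    using positive_onD(2)[OF pos] by simp
  define a where "a x = s *\<^sub>R A x" for x
  have a: "a \<in> bounded_ops UNIV"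
    using bounded_ops_scaled[OF A, of s] by (simp add: a_def[abs_def])
  have "(\<lambda>x. a x - x) \<in> bounded_ops UNIV"
    using bounded_ops_scaled_diff[OF a bounded_ops_ident, of 1] by simp
  moreover have "positive_on UNIV (\<lambda>x. a x - x)"
    using low AI
    by (auto simp: positive_on_def complex_nonneg_Reals_iff a_def cinner_simps cinner_self)
  ultimately obtain E where E: "E \<in> bounded_ops UNIV"
    and E2: "\<And>x. (norm (E x))\<^sup>2 = Re (cinner (a x - x) x)"
    by (rule positive_sqrt_exists[OF H]) simp
  let ?P = "\<lambda>x. s *\<^sub>R (A x - adjoint_on UNIV T (A (T x)))"
  have adj: "cinner (adjoint_on UNIV T y) x = cinner y (T x)" for x y
    using arg_cong[OF cinner_adjoint_on[OF H T, of x y], of cnj]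
    by (simp add: cinner_commute[symmetric])
  have "?P \<in> bounded_ops UNIV"
    by (rule bounded_ops_scaled_diff[OF A
          bounded_ops_comp[OF adjoint_on_bounded_ops[OF H T] bounded_ops_comp[OF A T]]]) simp
  moreover have "positive_on UNIV ?P"
    using le s
    by (auto simp: op_le_on_def positive_on_def complex_nonneg_Reals_iff cinner_simps)
  ultimately obtain D where D: "D \<in> bounded_ops UNIV"
    and D2: "\<And>x. (norm (D x))\<^sup>2 = Re (cinner (?P x) x)"
    by (rule positive_sqrt_exists[OF H]) simp
  have "lifting_data T E D"
  proof
    fix g
    have e: "(norm (E x))\<^sup>2 = s * Re (cinner (A x) x) - (norm x)\<^sup>2" for x
      by (simp add: E2 a_def cinner_simps cinner_self)
    have "(norm (D g))\<^sup>2 = s * Re (cinner (A g) g) - s * Re (cinner (A (T g)) (T g))"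
      by (simp add: D2 cinner_simps adj algebra_simps)
    then show "(norm (T g))\<^sup>2 + (norm (E (T g)))\<^sup>2 + (norm (D g))\<^sup>2 = (norm g)\<^sup>2 + (norm (E g))\<^sup>2"
      unfolding e by simp
  qed (fact T E D)+
  then show thesis by (rule that)
qed

theorem corollary3p3:
  fixes T :: "'h::chilbert_space \<Rightarrow> 'h"
  assumes "T \<in> bounded_ops UNIV"
    and "similar_to_contraction UNIV T"
  shows "\<exists>(K :: 'h ell2 set) J S.
    hilbert_subspace K \<and> hilbert_embedding K J \<and> minimal_lifting_on K J T S \<and>
    quasi_isometry_on K S \<and> similar_to_isometry K S"
proof -
  obtain E D where "lifting_data T E D"
    using lifting_data_exists[OF assms] by blast
  then interpret lifting_data T E D .
  define K where "K = closure (cspan (\<Union>n. (S ^^ n) ` range ell2_embed))"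
  note orbit = orbit_closed_span[OF lift_bounded_ops, of "range ell2_embed", folded K_def]
  have "hilbert_embedding K ell2_embed"
    using orbit(2) by (simp add: hilbert_embedding_def clinear_ell2_embed norm_ell2_embed)
  moreover have "minimal_lifting_on K ell2_embed T S"
    using orbit(3)
    by (simp add: minimal_lifting_on_def lifting_on_def orth_proj_ell2_embed
        quasi_isometric_lift.rep_eq K_def[symmetric])
  moreover have "quasi_isometry_on K S"
    by (rule quasi_isometry_onI[OF orbit(1,3) norm_lift_lift])
  moreover have "similar_to_isometry K S"
    by (rule quasi_isometric_similar_to_isometry[OF orbit(1,3) norm_lift_lift _ lift_bounded_below])
      simp
  ultimately show ?thesis using orbit(1) by blast
qed

end
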